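(* Fix $D\ge1$ and $k\ge2$, let $(r_n)$ be a sequence in $[0,1/2]$, and let $C_{n,k}$ be the number of connected components of $G_D(n;r_n)$ isomorphic to the complete graph $K_k$. If $$n^k r_n^{D(k-1)}\longrightarrow a\in[0,\infty)\qquad(n\to\infty),$$ then $$C_{n,k}\xrightarrow{d}\operatorname{Poisson}\left(\frac{k^D}{k!}a\right).$$ Consequently, if $a\in(0,\infty)$, the first-order sentence asserting the existence of a component isomorphic to $K_k$ has limiting probability $$1-\exp\left\{-\frac{k^D}{k!}a\right\},$$ which lies strictly between zero and one.
   Context: Let $\mathbb T^D=(\mathbb R/\mathbb Z)^D$, with torus $L^\infty$ metric $d_\infty(x,y)=\max_{1\le i\le D}\|x_i-y_i\|_{\mathbb T}$, where $\|t\|_{\mathbb T}=\min_{m\in\mathbb Z}|t-m|$. Let $X_1,\dots,X_n$ be independent uniform random points of $\mathbb T^D$. For $0\le r\le1/2$, $G_D(n;r)$ is the simple graph on $[n]=\{1,\dots,n\}$ in which distinct $i,j$ are adjacent iff $d_\infty(X_i,X_j)\le r$. Graphs are regarded as structures in the first-order language with equality and one binary relation symbol $E$. $\operatorname{Poisson}(\lambda)$ is the Poisson distribution with mean $\lambda$ (the point mass at $0$ if $\lambda=0$). *)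

theory Defs
  imports
    "HOL-Probability.Probability"
    "Graph_Theory.Graph_Theory"
begin

definition torus_norm :: "real \<Rightarrow> real" where
  "torus_norm t = (INF m::int. \<bar>t - of_int m\<bar>)"

text \<open>The infimum is a minimum, attained at the nearest integer.\<close>

lemma torus_norm_le: "torus_norm t \<le> \<bar>t - of_int m\<bar>"
  unfolding torus_norm_def by (rule cINF_lower) (auto intro!: bdd_belowI[of _ 0])

lemma torus_norm_round: "torus_norm t = \<bar>t - of_int (round t)\<bar>"
proof (rule antisym)
  show "torus_norm t \<le> \<bar>t - of_int (round t)\<bar>"
    by (rule torus_norm_le)
  show "\<bar>t - of_int (round t)\<bar> \<le> torus_norm t"
    unfolding torus_norm_def by (rule cINF_greatest) (auto intro: round_diff_minimal)
qed

lemma torus_norm_minus: "torus_norm (- t) = torus_norm t"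
proof -
  have "torus_norm (- t) \<le> torus_norm t" for t
    using torus_norm_le[of "- t" "- round t"] by (simp add: torus_norm_round[of t])
  from this[of t] this[of "- t"] show ?thesis by simp
qed

lemma torus_norm_triangle: "torus_norm (s + t) \<le> torus_norm s + torus_norm t"
  using torus_norm_le[of "s + t" "round s + round t"]
  by (simp add: torus_norm_round[of s] torus_norm_round[of t])

lemma torus_norm_eq_0_iff: "torus_norm t = 0 \<longleftrightarrow> t \<in> \<int>"
proof
  assume "torus_norm t = 0"
  then have "t = of_int (round t)" by (simp add: torus_norm_round)
  then show "t \<in> \<int>" by (metis Ints_of_int)
next
  assume "t \<in> \<int>"
  then show "torus_norm t = 0" by (auto simp: torus_norm_round elim: Ints_cases)
qed

lemma torus_norm_cong:
  assumes "s - t \<in> \<int>"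
  shows "torus_norm s = torus_norm t"
  using torus_norm_triangle[of "s - t" t] torus_norm_triangle[of "t - s" s]
    torus_norm_minus[of "s - t"] assms
  by (simp add: torus_norm_eq_0_iff[THEN iffD2])

quotient_type circle = real / "\<lambda>s t :: real. s - t \<in> \<int>"
  morphisms rep_circle to_circle
proof (rule equivpI)
  show "reflp (\<lambda>s t :: real. s - t \<in> \<int>)"
    by (simp add: reflp_def)
  show "symp (\<lambda>s t :: real. s - t \<in> \<int>)"
    by (metis (no_types, lifting) Ints_minus minus_diff_eq sympI)
  show "transp (\<lambda>s t :: real. s - t \<in> \<int>)"
    by (rule transpI) (metis (no_types, lifting) Ints_add diff_add_cancel add_diff_eq)
qed

instantiation circle :: metric_space
begin

lift_definition dist_circle :: "circle \<Rightarrow> circle \<Rightarrow> real" is "\<lambda>s t. torus_norm (s - t)"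
proof (rule torus_norm_cong)
  fix s s' t t' :: real
  assume "s - s' \<in> \<int>" "t - t' \<in> \<int>"
  then have "(s - s') - (t - t') \<in> \<int>" by (rule Ints_diff)
  then show "(s - t) - (s' - t') \<in> \<int>" by (simp add: algebra_simps)
qed

definition uniformity_circle :: "(circle \<times> circle) filter" where
  "uniformity_circle = (INF e\<in>{0<..}. principal {(x, y). dist x y < e})"

definition open_circle :: "circle set \<Rightarrow> bool" where
  "open_circle U = (\<forall>x\<in>U. eventually (\<lambda>(x', y). x' = x \<longrightarrow> y \<in> U) uniformity)"

instance
proof
  show "dist x y = 0 \<longleftrightarrow> x = y" for x y :: circle
    by transfer (simp add: torus_norm_eq_0_iff)
  show "dist x y \<le> dist x z + dist y z" for x y z :: circle
  proof transfer
    fix x y z :: real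
    show "torus_norm (x - y) \<le> torus_norm (x - z) + torus_norm (y - z)"
      using torus_norm_triangle[of "x - z" "z - y"] torus_norm_minus[of "z - y"] by simp
  qed
qed (simp_all add: uniformity_circle_def open_circle_def)

end

text \<open>The uniform distribution on \<open>\<real>/\<int>\<close> is the image of Lebesgue measure on the
  fundamental domain \<open>[0,1)\<close>.\<close>

definition circle_uniform :: "circle measure" where
  "circle_uniform = distr (uniform_measure lborel {0..<1}) borel to_circle"

text \<open>Points of the \<open>D\<close>-dimensional torus are functions on \<open>{1..D}\<close>, extended by
  \<open>undefined\<close>, as in \<^const>\<open>PiM\<close>.\<close>

definition torus_uniform :: "nat \<Rightarrow> (nat \<Rightarrow> circle) measure" where
  "torus_uniform D = PiM {1..D} (\<lambda>_. circle_uniform)"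

text \<open>Meaningful for \<open>D \<ge> 1\<close> only, since \<open>Max {}\<close> is unspecified.\<close>

definition torus_dist :: "nat \<Rightarrow> (nat \<Rightarrow> circle) \<Rightarrow> (nat \<Rightarrow> circle) \<Rightarrow> real" where
  "torus_dist D x y = (MAX i\<in>{1..D}. dist (x i) (y i))"

text \<open>Simple graphs are symmetric, loop-free digraphs without parallel arcs (\<^locale>\<open>pair_graph\<close>).\<close>

definition geometric_graph ::
    "nat \<Rightarrow> nat \<Rightarrow> real \<Rightarrow> (nat \<Rightarrow> nat \<Rightarrow> circle) \<Rightarrow> nat pair_pre_digraph" where
  "geometric_graph D n r x =
    \<lparr> pverts = {1..n},
      parcs = {(i, j). i \<in> {1..n} \<and> j \<in> {1..n} \<and> i \<noteq> j \<and> torus_dist D (x i) (x j) \<le> r} \<rparr>"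

definition complete_graph :: "nat \<Rightarrow> nat pair_pre_digraph" where
  "complete_graph k =
    \<lparr> pverts = {1..k}, parcs = {(i, j). i \<in> {1..k} \<and> j \<in> {1..k} \<and> i \<noteq> j} \<rparr>"

definition components :: "'a pair_pre_digraph \<Rightarrow> ('a, 'a \<times> 'a) pre_digraph set" where
  "components G = {H. pre_digraph.max_subgraph (with_proj G) Digraph_Component.connected H}"

definition complete_components ::
    "nat \<Rightarrow> 'a pair_pre_digraph \<Rightarrow> ('a, 'a \<times> 'a) pre_digraph set" where
  "complete_components k G = {H \<in> components G. digraph_iso H (with_proj (complete_graph k))}"

datatype fo_formula =
    Eq nat nat
  | Edge nat nat
  | Neg fo_formula
  | Conj fo_formula fo_formula
  | Exists nat fo_formula

fun free_vars :: "fo_formula \<Rightarrow> nat set" where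
  "free_vars (Eq x y) = {x, y}"
| "free_vars (Edge x y) = {x, y}"
| "free_vars (Neg \<phi>) = free_vars \<phi>"
| "free_vars (Conj \<phi> \<psi>) = free_vars \<phi> \<union> free_vars \<psi>"
| "free_vars (Exists x \<phi>) = free_vars \<phi> - {x}"

definition fo_sentence :: "fo_formula \<Rightarrow> bool" where
  "fo_sentence \<phi> \<longleftrightarrow> free_vars \<phi> = {}"

fun fo_sat :: "'a pair_pre_digraph \<Rightarrow> (nat \<Rightarrow> 'a) \<Rightarrow> fo_formula \<Rightarrow> bool" where
  "fo_sat G e (Eq x y) \<longleftrightarrow> e x = e y"
| "fo_sat G e (Edge x y) \<longleftrightarrow> (e x, e y) \<in> parcs G"
| "fo_sat G e (Neg \<phi>) \<longleftrightarrow> \<not> fo_sat G e \<phi>"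
| "fo_sat G e (Conj \<phi> \<psi>) \<longleftrightarrow> fo_sat G e \<phi> \<and> fo_sat G e \<psi>"
| "fo_sat G e (Exists x \<phi>) \<longleftrightarrow> (\<exists>v \<in> pverts G. fo_sat G (e(x := v)) \<phi>)"

text \<open>The truth value of a sentence does not depend on the assignment, so the quantifier over
  (not necessarily \<open>G\<close>-valued) assignments is immaterial.\<close>

definition fo_models :: "'a pair_pre_digraph \<Rightarrow> fo_formula \<Rightarrow> bool" where
  "fo_models G \<phi> \<longleftrightarrow> (\<forall>e. fo_sat G e \<phi>)"

text \<open>Such a sentence is unique up to equivalence over finite simple graphs.\<close>

definition asserts_complete_component :: "nat \<Rightarrow> fo_formula \<Rightarrow> bool" where
  "asserts_complete_component k \<phi> \<longleftrightarrow>
    fo_sentence \<phi> \<and>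
    (\<forall>G :: nat pair_pre_digraph. pair_graph G \<longrightarrow>
      (fo_models G \<phi> \<longleftrightarrow> complete_components k G \<noteq> {}))"

text \<open>The library's \<^const>\<open>poisson_pmf\<close> is specified for positive rates only.\<close>

definition poisson_dist :: "real \<Rightarrow> nat pmf" where
  "poisson_dist \<mu> = (if \<mu> = 0 then return_pmf 0 else poisson_pmf \<mu>)"

end

theory Submission
  imports Defs
begin

text \<open>
  Poisson convergence by factorial moments. The vertex sets of the \<open>K\<^sub>k\<close>-components of a graph are
  its isolated \<open>k\<close>-cliques, and these are pairwise disjoint; so \<open>C choose m\<close> counts the families of
  \<open>m\<close> disjoint \<open>k\<close>-sets all of whose members are isolated cliques. For \<open>r < 1/3\<close> a family consists of
  cliques with probability exactly \<open>(k r\<^bsup>k-1\<^esup>)\<^bsup>mD\<^esup>\<close>: the coordinates are independent, and on the circle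
  a clique has a unique leftmost point, relative to which the others are independent. An edge
  leaving the family costs a further factor of order \<open>n r\<^sup>D \<longlonglongrightarrow> 0\<close>. Hence
  the \<open>m\<close>-th binomial moment tends to \<open>\<mu>\<^sup>m / m!\<close> with \<open>\<mu> = k\<^sup>D a / k!\<close>, and the Bonferroni
  inequalities turn this into convergence of the point probabilities.
\<close>

section \<open>Complete components and isolated cliques\<close>

text \<open>Counting isolated cliques instead of all cliques keeps the moments elementary: families
  with overlapping members never contribute. There are about \<open>n^(k m) / (k!^m m!)\<close>
  admissible families. Multiplied by the clique probability this gives about
  \<open>((k^D / k!) x)^m / m!\<close>, where \<open>x = n^k r^(D (k - 1))\<close>, which is the
  binomial moment of the Poisson law. The factor \<open>k^D\<close> is the number of ways to choose
  a leftmost point separately in each of the \<open>D\<close> coordinates. The bound 1/3 excludes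
  cliques that wind around the circle: three points at mutual distance 1/3 are pairwise close, but
  none of them is leftmost. Single radii may be as large as 1/2, so the exact formula is available
  only from some \<open>n\<close> on. It does become available, because
  \<open>x = n (n r^D)^(k - 1)\<close> converges and \<open>k \<ge> 2\<close>; this forces
  \<open>n r^D\<close>, and with it \<open>r\<close>, to tend to 0.\<close>

definition isolated_cliques :: "nat \<Rightarrow> 'a set \<Rightarrow> ('a \<Rightarrow> 'a \<Rightarrow> bool) \<Rightarrow> 'a set set" where
  "isolated_cliques k V E = {S. S \<subseteq> V \<and> card S = k \<and>
     (\<forall>u\<in>S. \<forall>v\<in>S. u \<noteq> v \<longrightarrow> E u v) \<and> (\<forall>u\<in>S. \<forall>v\<in>V - S. \<not> E u v)}"

lemma rtrancl_on_closed:
  assumes "(u, v) \<in> rtrancl_on V R" "u \<in> S" "\<And>x y. (x, y) \<in> R \<Longrightarrow> x \<in> S \<Longrightarrow> y \<in> S"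
  shows "v \<in> S"
  using assms(1,2)
proof induct
  case base
  then show ?case by blast
next
  case (step x y)
  then show ?case using assms(3) by blast
qed

text \<open>Injectivity on vertices sends \<open>u\<close> and \<open>v\<close> to distinct vertices
  of the complete graph, whose arc is the image of some arc of \<open>H\<close>. Injectivity again
  identifies the ends of that arc as \<open>u\<close> and \<open>v\<close>.\<close>

lemma arc_of_iso_complete_graph:
  assumes iso: "digraph_iso H (with_proj (complete_graph k))"
    and uv: "u \<in> verts H" "v \<in> verts H" "u \<noteq> v"
  shows "\<exists>e\<in>arcs H. tail H e = u \<and> head H e = v"
proof -
  obtain f where f: "pre_digraph.digraph_isomorphism H f"
    and K: "with_proj (complete_graph k) = app_iso f H"
    using iso by (auto simp: digraph_iso_def)
  have inj: "inj_on (iso_verts f) (verts H)" and wf: "wf_digraph H"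
    and ends: "\<And>e. e \<in> arcs H \<Longrightarrow> iso_verts f (tail H e) = iso_tail f (iso_arcs f e)"
      "\<And>e. e \<in> arcs H \<Longrightarrow> iso_verts f (head H e) = iso_head f (iso_arcs f e)"
    using f by (auto simp: pre_digraph.digraph_isomorphism_def)
  have hd: "iso_head f = snd" and tl: "iso_tail f = fst"
    using arg_cong[OF K, of head] arg_cong[OF K, of tail] by simp_all
  have vs: "iso_verts f ` verts H = {1..k}"
    using arg_cong[OF K, of verts] by (simp add: complete_graph_def)
  have as: "iso_arcs f ` arcs H = {(i, j). i \<in> {1..k} \<and> j \<in> {1..k} \<and> i \<noteq> j}"
    using arg_cong[OF K, of arcs] by (simp add: complete_graph_def)
  have "iso_verts f u \<noteq> iso_verts f v" using inj uv by (auto dest: inj_onD)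
  with vs uv have "(iso_verts f u, iso_verts f v) \<in> iso_arcs f ` arcs H"
    unfolding as by auto
  then obtain e where e: "e \<in> arcs H" "iso_arcs f e = (iso_verts f u, iso_verts f v)" by force
  from ends[OF e(1)] e(2) hd tl
  have "iso_verts f (tail H e) = iso_verts f u" "iso_verts f (head H e) = iso_verts f v" by auto
  then have "tail H e = u" "head H e = v"
    using inj uv wf e(1) by (auto dest: inj_onD simp: wf_digraph.tail_in_verts wf_digraph.head_in_verts)
  with e show ?thesis by blast
qed

lemma card_verts_iso_complete_graph:
  assumes iso: "digraph_iso H (with_proj (complete_graph k))"
  shows "card (verts H) = k"
proof -
  obtain f where f: "pre_digraph.digraph_isomorphism H f"
    and K: "with_proj (complete_graph k) = app_iso f H"
    using iso by (auto simp: digraph_iso_def)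
  have "iso_verts f ` verts H = {1..k}"
    using arg_cong[OF K, of verts] by (simp add: complete_graph_def)
  moreover have "inj_on (iso_verts f) (verts H)"
    using f by (auto simp: pre_digraph.digraph_isomorphism_def)
  ultimately show ?thesis by (metis card_atLeastAtMost card_image diff_Suc_1)
qed

text \<open>Any bijection \<open>g\<close> of the vertices works: arcs are pairs here, so
  \<open>map_prod g g\<close> is the matching map on arcs.\<close>

lemma iso_complete_graphI:
  assumes wf: "wf_digraph H" and fin: "finite (verts H)" and k: "card (verts H) = k"
    and arcs: "arcs H = {(u, v). u \<in> verts H \<and> v \<in> verts H \<and> u \<noteq> v}"
    and ends: "tail H = fst" "head H = snd"
  shows "digraph_iso H (with_proj (complete_graph k))"
proof -
  obtain g where g: "bij_betw g (verts H) {1..k}"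
    using fin k by (metis bij_betw_iff_card card_atLeastAtMost diff_Suc_1 finite_atLeastAtMost)
  define f where "f = \<lparr>iso_verts = g, iso_arcs = map_prod g g, iso_head = snd, iso_tail = fst\<rparr>"
  have inj: "inj_on g (verts H)" and im: "g ` verts H = {1..k}"
    using g by (auto simp: bij_betw_def)
  have "pre_digraph.digraph_isomorphism H f"
    unfolding pre_digraph.digraph_isomorphism_def f_def using wf inj
    by (auto simp: ends arcs inj_on_def)
  moreover have "map_prod g g ` arcs H = {(i, j). i \<in> {1..k} \<and> j \<in> {1..k} \<and> i \<noteq> j}"
  proof (intro equalityI subsetI)
    fix p assume "p \<in> map_prod g g ` arcs H"
    then show "p \<in> {(i, j). i \<in> {1..k} \<and> j \<in> {1..k} \<and> i \<noteq> j}"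
      using im inj by (auto simp: arcs inj_on_def)
  next
    fix p assume "p \<in> {(i, j). i \<in> {1..k} \<and> j \<in> {1..k} \<and> i \<noteq> j}"
    then obtain i j where p: "p = (i, j)" "i \<in> g ` verts H" "j \<in> g ` verts H" "i \<noteq> j"
      unfolding im by blast
    then obtain u v where "u \<in> verts H" "v \<in> verts H" "i = g u" "j = g v" by blast
    with p show "p \<in> map_prod g g ` arcs H"
      by (intro image_eqI[of _ _ "(u, v)"]) (auto simp: arcs)
  qed
  then have "with_proj (complete_graph k) = app_iso f H"
    using im by (simp add: app_iso_def f_def with_proj_def complete_graph_def)
  ultimately show ?thesis unfolding digraph_iso_def by blast
qed

text \<open>If an arc left \<open>verts H\<close> for \<open>w\<close>, the subgraph induced on
  \<open>verts H\<close> and \<open>w\<close> would still be connected, against maximality. The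
  second conclusion recovers \<open>H\<close> from its vertex set, so that counting vertex sets
  counts components.\<close>

lemma (in pair_graph) complete_component_isolated:
  assumes H: "H \<in> complete_components k G"
  shows "verts H \<in> isolated_cliques k (pverts G) (\<lambda>u v. (u, v) \<in> parcs G)"
    and "H = with_proj G \<restriction> verts H"
proof -
  have sub: "subgraph H (with_proj G)" and con: "Digraph_Component.connected H"
    and mx: "\<And>H'. H' \<noteq> H \<Longrightarrow> subgraph H H' \<Longrightarrow> subgraph H' (with_proj G)
      \<Longrightarrow> \<not> Digraph_Component.connected H'"
    and iso: "digraph_iso H (with_proj (complete_graph k))"
    using H by (auto simp: complete_components_def components_def max_subgraph_def)
  have tl: "tail H = fst" and hd: "head H = snd"
    and vs: "verts H \<subseteq> pverts G" and as: "arcs H \<subseteq> parcs G"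
    and wf: "wf_digraph H"
    using sub by (auto simp: subgraph_def compatible_def)
  have arc: "(u, v) \<in> arcs H" if "u \<in> verts H" "v \<in> verts H" "u \<noteq> v" for u v
    using arc_of_iso_complete_graph[OF iso that] by (auto simp: tl hd)
  have arcs_eq: "arcs H = {e \<in> parcs G. fst e \<in> verts H \<and> snd e \<in> verts H}"
  proof (intro equalityI subsetI)
    fix e assume "e \<in> arcs H"
    then show "e \<in> {e \<in> parcs G. fst e \<in> verts H \<and> snd e \<in> verts H}"
      using as wf_digraph.tail_in_verts[OF wf] wf_digraph.head_in_verts[OF wf] by (auto simp: tl hd)
  next
    fix e assume "e \<in> {e \<in> parcs G. fst e \<in> verts H \<and> snd e \<in> verts H}"
    then show "e \<in> arcs H"
      using arc[of "fst e" "snd e"] pair_no_loops[of e] by auto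
  qed
  show "H = with_proj G \<restriction> verts H"
    by (rule pre_digraph.equality) (auto simp: tl hd arcs_eq)
  have isol: "\<not> (u, w) \<in> parcs G" if u: "u \<in> verts H" and w: "w \<in> pverts G - verts H" for u w
  proof
    assume uw: "(u, w) \<in> parcs G"
    define W where "W = insert w (verts H)"
    define H' where "H' = with_proj G \<restriction> W"
    have W: "W \<subseteq> pverts G" using vs w by (auto simp: W_def)
    have wfH': "wf_digraph H'"
      unfolding H'_def by (rule wellformed_induce_subgraph)
    have "w \<in> verts H'" by (simp add: H'_def W_def)
    then have "H' \<noteq> H" using w by blast
    moreover have "subgraph H H'"
      using wf wfH' as by (auto simp: subgraph_def H'_def W_def compatible_def tl hd arcs_eq)
    moreover have "subgraph H' (with_proj G)"
      unfolding H'_def using W by (rule subgraph_induce_subgraphI[simplified])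
    moreover have "Digraph_Component.connected H'"
      unfolding connected_conv
    proof (intro conjI ballI)
      show "verts H' \<noteq> {}" by (auto simp: H'_def W_def)
      fix x y assume x: "x \<in> verts H'" and y: "y \<in> verts H'"
      let ?R = "rtrancl_on (verts H') ((arcs_ends H')\<^sup>s)"
      have ends: "arcs_ends H' = {(a, b) \<in> parcs G. a \<in> W \<and> b \<in> W}"
        by (auto simp: arcs_ends_def arc_to_ends_def H'_def)
      \<comment> \<open>The vertex \<open>u\<close> is a hub: it is adjacent to every other vertex
        of \<open>H'\<close>, to \<open>w\<close> by assumption and to the rest by
        completeness.\<close>
      have toU: "(z, u) \<in> ?R \<and> (u, z) \<in> ?R" if z: "z \<in> verts H'" for z
      proof (cases "z = u")
        case True then show ?thesis using z by auto
      next
        case False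
        have "(z, u) \<in> (arcs_ends H')\<^sup>s \<and> (u, z) \<in> (arcs_ends H')\<^sup>s"
          using False z arc[of z u] arc[of u z] as u uw graph_symmetric[OF uw]
          unfolding symcl_def ends by (auto simp: H'_def W_def)
        then show ?thesis using z u
          by (auto simp: H'_def W_def intro!: rtrancl_on_into_rtrancl_on[OF rtrancl_on_refl])
      qed
      show "(x, y) \<in> ?R"
        using toU[OF x] toU[OF y] by (blast intro: rtrancl_on_trans)
    qed
    ultimately show False using mx by blast
  qed
  show "verts H \<in> isolated_cliques k (pverts G) (\<lambda>u v. (u, v) \<in> parcs G)"
    using vs card_verts_iso_complete_graph[OF iso] arc as isol
    by (auto simp: isolated_cliques_def)
qed

text \<open>Isolation makes \<open>S\<close> closed under arcs, so no connected subgraph that meets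
  \<open>S\<close> can contain a vertex outside it.\<close>

lemma (in pair_graph) isolated_clique_complete_component:
  assumes S: "S \<in> isolated_cliques k (pverts G) (\<lambda>u v. (u, v) \<in> parcs G)" and k: "k \<ge> 1"
  shows "with_proj G \<restriction> S \<in> complete_components k G"
proof -
  have SV: "S \<subseteq> pverts G" and card: "card S = k"
    and cl: "\<And>u v. u \<in> S \<Longrightarrow> v \<in> S \<Longrightarrow> u \<noteq> v \<Longrightarrow> (u, v) \<in> parcs G"
    and isol: "\<And>u v. u \<in> S \<Longrightarrow> v \<in> pverts G - S \<Longrightarrow> (u, v) \<notin> parcs G"
    using S by (auto simp: isolated_cliques_def)
  have fin: "finite S" using card k card.infinite by fastforce
  let ?H = "with_proj G \<restriction> S"
  have wfH: "wf_digraph ?H" by (rule wellformed_induce_subgraph)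
  have sub: "subgraph ?H (with_proj G)"
    using SV by (rule subgraph_induce_subgraphI[simplified])
  have arcs: "arcs ?H = {(u, v). u \<in> S \<and> v \<in> S \<and> u \<noteq> v}"
    using cl pair_no_loops by fastforce
  have con: "Digraph_Component.connected ?H"
    unfolding connected_conv
  proof (intro conjI ballI)
    show "verts ?H \<noteq> {}" using card k by auto
    fix u v assume uv: "u \<in> verts ?H" "v \<in> verts ?H"
    show "(u, v) \<in> rtrancl_on (verts ?H) ((arcs_ends ?H)\<^sup>s)"
    proof (cases "u = v")
      case True then show ?thesis using uv by auto
    next
      case False
      then have "(u, v) \<in> (arcs_ends ?H)\<^sup>s"
        using uv cl[of u v] by (auto simp: symcl_def arcs_ends_def arc_to_ends_def intro!: image_eqI)
      then show ?thesis using uv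
        by (auto intro!: rtrancl_on_into_rtrancl_on[OF rtrancl_on_refl])
    qed
  qed
  have "max_subgraph Digraph_Component.connected ?H"
  proof (rule max_subgraphI)
    show "Digraph_Component.connected ?H" by (rule con)
    show "subgraph ?H (with_proj G)" by (rule sub)
    fix H' assume ne: "?H \<noteq> H'" and s1: "subgraph ?H H'" and s2: "subgraph H' (with_proj G)"
    have tl: "tail H' = fst" and hd: "head H' = snd"
      and vs: "verts H' \<subseteq> pverts G" and as: "arcs H' \<subseteq> parcs G"
      and wf: "wf_digraph H'" and SH: "S \<subseteq> verts H'" and aS: "arcs ?H \<subseteq> arcs H'"
      using s1 s2 by (auto simp: subgraph_def compatible_def)
    \<comment> \<open>On the vertex set \<open>S\<close> nothing can be added, since the induced
      subgraph already has every arc available.\<close>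
    have "verts H' \<noteq> S"
    proof
      assume "verts H' = S"
      then have "arcs H' = arcs ?H"
        using as aS wf tl hd by (fastforce simp: wf_digraph_def)
      with \<open>verts H' = S\<close> have "?H = H'"
        by (intro pre_digraph.equality) (auto simp: tl hd)
      with ne show False by blast
    qed
    then obtain w where w: "w \<in> verts H'" "w \<notin> S" using SH by blast
    obtain u where u: "u \<in> S" using card k by fastforce
    have closed: "y \<in> S" if "(x, y) \<in> (arcs_ends H')\<^sup>s" "x \<in> S" for x y
    proof -
      have "(x, y) \<in> parcs G"
        using that as graph_symmetric by (auto simp: symcl_def arcs_ends_def arc_to_ends_def tl hd)
      then show ?thesis using isol[of x y] that(2) in_arcsD2 by blast
    qed
    show "\<not> Digraph_Component.connected H'"
    proof
      assume "Digraph_Component.connected H'"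
      then have "(u, w) \<in> rtrancl_on (verts H') ((arcs_ends H')\<^sup>s)"
        using u w SH by (auto simp: connected_conv)
      from this u have "w \<in> S" by (rule rtrancl_on_closed) (rule closed)
      with w show False by blast
    qed
  qed
  moreover have "digraph_iso ?H (with_proj (complete_graph k))"
    by (rule iso_complete_graphI[OF wfH]) (auto simp: fin card arcs[simplified])
  ultimately show ?thesis by (simp add: complete_components_def components_def)
qed

lemma (in pair_graph) bij_betw_complete_components:
  assumes "k \<ge> 1"
  shows "bij_betw verts (complete_components k G)
           (isolated_cliques k (pverts G) (\<lambda>u v. (u, v) \<in> parcs G))"
proof (rule bij_betwI[where g = "\<lambda>S. with_proj G \<restriction> S"])
  show "verts \<in> complete_components k G \<rightarrow> isolated_cliques k (pverts G) (\<lambda>u v. (u, v) \<in> parcs G)"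
    using complete_component_isolated(1) by blast
  show "(\<restriction>) (with_proj G) \<in> isolated_cliques k (pverts G) (\<lambda>u v. (u, v) \<in> parcs G) \<rightarrow> complete_components k G"
    using isolated_clique_complete_component assms by blast
  show "with_proj G \<restriction> verts H = H" if "H \<in> complete_components k G" for H
    using complete_component_isolated(2)[OF that] by simp
qed simp

section \<open>Binomial moments and Poisson limits\<close>

definition packings :: "nat \<Rightarrow> nat \<Rightarrow> 'a set \<Rightarrow> 'a set set set" where
  "packings k m V = {F. finite F \<and> card F = m \<and> disjoint F \<and> (\<forall>S\<in>F. S \<subseteq> V \<and> card S = k)}"

lemma finite_packings: "finite V \<Longrightarrow> finite (packings k m V)"
  by (rule finite_subset[of _ "Pow (Pow V)"]) (auto simp: packings_def)

lemma card_Union_packing: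
  assumes "F \<in> packings k m V" "finite V"
  shows "card (\<Union>F) = k * m" "\<Union>F \<subseteq> V"
proof -
  have "card (\<Union>F) = (\<Sum>S\<in>F. card S)"
    using assms by (intro card_Union_disjoint) (auto simp: packings_def intro: finite_subset)
  also have "\<dots> = k * m" using assms by (simp add: packings_def)
  finally show "card (\<Union>F) = k * m" .
qed (use assms in \<open>auto simp: packings_def\<close>)

lemma packings_0: "packings k 0 V = {{}}"
  by (auto simp: packings_def disjoint_def)

lemma card_packings_Suc:
  assumes V: "finite V" and k: "k \<ge> 1"
  shows "Suc m * card (packings k (Suc m) V) = card (packings k m V) * ((card V - k * m) choose k)"
proof -
  let ?A = "SIGMA F:packings k (Suc m) V. F"
  let ?B = "SIGMA F:packings k m V. {S. S \<subseteq> V - \<Union>F \<and> card S = k}"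
  have "bij_betw (\<lambda>(F, S). (F - {S}, S)) ?A ?B"
  proof (rule bij_betwI[where g = "\<lambda>(F, S). (insert S F, S)"])
    show "(\<lambda>(F, S). (F - {S}, S)) \<in> ?A \<rightarrow> ?B"
      by (fastforce simp: packings_def disjoint_def)
    show "(\<lambda>(F, S). (insert S F, S)) \<in> ?B \<rightarrow> ?A"
    proof (rule funcsetI)
      fix x assume "x \<in> ?B"
      then obtain F S where x: "x = (F, S)" and F: "F \<in> packings k m V"
        and S: "S \<subseteq> V - \<Union>F" "card S = k" by blast
      have "S \<noteq> {}" using S(2) k by auto
      with S(1) have "S \<notin> F" by blast
      then show "(\<lambda>(F, S). (insert S F, S)) x \<in> ?A"
        using F S by (auto simp: x packings_def disjoint_def)
    qed
    show "(case case x of (F, S) \<Rightarrow> (F - {S}, S) of (F, S) \<Rightarrow> (insert S F, S)) = x" if "x \<in> ?A" for x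
      using that by auto
    show "(case case y of (F, S) \<Rightarrow> (insert S F, S) of (F, S) \<Rightarrow> (F - {S}, S)) = y" if yB: "y \<in> ?B" for y
    proof -
      obtain F S where y: "y = (F, S)" "S \<subseteq> V - \<Union>F" "card S = k" using yB by auto
      moreover have "S \<noteq> {}" using y(3) k by auto
      ultimately have "S \<notin> F" by blast
      with y show ?thesis by simp
    qed
  qed
  then have "card ?A = card ?B" by (rule bij_betw_same_card)
  moreover have "card ?A = Suc m * card (packings k (Suc m) V)"
    using finite_packings[OF V] by (subst card_SigmaI) (auto simp: packings_def)
  moreover have "card ?B = card (packings k m V) * ((card V - k * m) choose k)"
  proof -
    have "card {S. S \<subseteq> V - \<Union>F \<and> card S = k} = (card V - k * m) choose k"
      if F: "F \<in> packings k m V" for F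
      using card_Union_packing[OF F V] V
      by (subst n_subsets) (auto simp: card_Diff_subset finite_subset)
    then show ?thesis
      using finite_packings[OF V] V by (subst card_SigmaI) auto
  qed
  ultimately show ?thesis by simp
qed

lemma choose_asymp:
  "(\<lambda>n. real ((n - c) choose k) / real n ^ k) \<longlonglongrightarrow> 1 / fact k"
proof -
  have "(\<lambda>n. (\<Prod>i\<in>{0..<k}. (real n - real c - real i) / real n) / fact k)
     \<longlonglongrightarrow> (\<Prod>i\<in>{0..<k}. 1) / fact k"
  proof (intro tendsto_divide tendsto_prod tendsto_const)
    fix i
    show "(\<lambda>n. (real n - real c - real i) / real n) \<longlonglongrightarrow> 1" by real_asymp
  qed auto
  \<comment> \<open>From \<open>n \<ge> c\<close> on, the truncated subtraction agrees with the real
    one.\<close>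
  moreover have "eventually (\<lambda>n. (\<Prod>i\<in>{0..<k}. (real n - real c - real i) / real n) / fact k
     = real ((n - c) choose k) / real n ^ k) sequentially"
    using eventually_ge_at_top[of c]
  proof eventually_elim
    case (elim n)
    have "real ((n - c) choose k) = (\<Prod>i\<in>{0..<k}. real n - real c - real i) / fact k"
      using elim by (simp add: binomial_gbinomial gbinomial_prod_rev of_nat_diff)
    then show ?case by (simp add: prod_dividef)
  qed
  ultimately show ?thesis by (simp add: filterlim_cong)
qed

text \<open>By the recursion, the member number \<open>m + 1\<close> contributes about
  \<open>n^k / k!\<close> choices and the factor \<open>1 / (m + 1)\<close> for forgetting the
  order.\<close>

lemma card_packings_asymp:
  assumes k: "k \<ge> 1"
  shows "(\<lambda>n. real (card (packings k m {1..n})) / real n ^ (k * m)) \<longlonglongrightarrow> 1 / (fact k ^ m * fact m)"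
proof (induction m)
  case 0
  then show ?case by (simp add: packings_0)
next
  case (Suc m)
  have eq: "real (card (packings k (Suc m) {1..n})) / real n ^ (k * Suc m) =
     (real (card (packings k m {1..n})) / real n ^ (k * m)) * (real ((n - k * m) choose k) / real n ^ k)
     / real (Suc m)" for n
  proof -
    have "real (Suc m) * real (card (packings k (Suc m) {1..n})) =
        real (card (packings k m {1..n})) * real ((n - k * m) choose k)"
      using card_packings_Suc[OF finite_atLeastAtMost[of 1 n] k, of m]
      unfolding of_nat_mult[symmetric] by simp
    then have "real (card (packings k (Suc m) {1..n})) =
        real (card (packings k m {1..n})) * real ((n - k * m) choose k) / real (Suc m)"
      by (simp add: nonzero_eq_divide_eq mult.commute del: of_nat_Suc)
    then show ?thesis by (simp add: power_add del: of_nat_Suc)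
  qed
  have "(\<lambda>n. (real (card (packings k m {1..n})) / real n ^ (k * m)) *
      (real ((n - k * m) choose k) / real n ^ k) / real (Suc m))
    \<longlonglongrightarrow> 1 / (fact k ^ m * fact m) * (1 / fact k) / real (Suc m)"
    by (intro tendsto_intros Suc choose_asymp) auto
  then show ?case unfolding eq by (simp add: mult_ac)
qed

section \<open>Bonferroni inequalities and convergence of point probabilities\<close>

lemma alternating_binomial_sum:
  "(\<Sum>i\<le>N. (-1) ^ i * real (Suc a choose i)) = (-1) ^ N * real (a choose N)"
  \<comment> \<open>Pascal's rule telescopes the sum. The upper index \<open>Suc a\<close> excludes
    0, for which every partial sum is 1.\<close>
  by (induction N) (auto simp: algebra_simps)

text \<open>The product of binomials equals \<open>(w choose j) * (w - j choose i)\<close>. For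
  \<open>w > j\<close> the alternating sum over \<open>i\<close> then collapses, up to sign, to
  \<open>w - j - 1 choose N\<close>, which is at most \<open>w - j choose Suc N\<close>. Hence the
  error is bounded by the first omitted term, whatever the parity of \<open>N\<close>.\<close>

lemma bonferroni:
  "\<bar>(if w = j then 1 else 0) - (\<Sum>i\<le>N. (-1) ^ i * real (j + i choose j) * real (w choose (j + i)))\<bar>
     \<le> real (j + Suc N choose j) * real (w choose (j + Suc N))"
proof -
  have mult: "real (j + i choose j) * real (w choose (j + i)) = real (w choose j) * real (w - j choose i)" for i
  proof (cases "j + i \<le> w")
    case True
    then have "(w choose (j + i)) * (j + i choose j) = (w choose j) * (w - j choose i)"
      using choose_mult[of j "j + i" w] by simp
    then show ?thesis by (metis mult.commute of_nat_mult)
  next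
    case False
    then show ?thesis by (cases "j \<le> w") (auto simp: binomial_eq_0)
  qed
  have sum: "(\<Sum>i\<le>N. (-1) ^ i * real (j + i choose j) * real (w choose (j + i)))
     = real (w choose j) * (\<Sum>i\<le>N. (-1) ^ i * real (w - j choose i))"
    unfolding sum_distrib_left by (intro sum.cong refl) (metis mult mult.left_commute mult.assoc)
  consider "w < j" | "w = j" | a where "w - j = Suc a" "w \<noteq> j" "w - j > 0"
    by (metis Suc_pred linorder_neqE_nat zero_less_diff)
  then show ?thesis
  proof cases
    case 1
    then show ?thesis unfolding sum mult by (simp add: binomial_eq_0)
  next
    case 2
    have "(\<Sum>i\<le>N. (-1) ^ i * real (0 choose i)) = 1"
      by (subst sum.atMost_shift) simp
    with 2 show ?thesis unfolding sum mult by simp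
  next
    case 3
    have "real (a choose N) \<le> real (Suc a choose Suc N)" by simp
    then have "real (w choose j) * real (a choose N) \<le> real (w choose j) * real (Suc a choose Suc N)"
      by (rule mult_left_mono) simp
    with 3 show ?thesis unfolding sum mult 3(1) alternating_binomial_sum
      by (simp add: abs_mult power_abs)
  qed
qed

text \<open>This replaces an interchange of limits: the truncation level \<open>N\<close> is fixed
  first, from the limits \<open>s\<close> and \<open>t\<close> alone, and only then does
  \<open>n\<close> grow.\<close>

lemma tendsto_truncation:
  fixes p :: "nat \<Rightarrow> real"
  assumes bound: "\<And>n N. \<bar>p n - S n N\<bar> \<le> e n N"
    and S: "\<And>N. (\<lambda>n. S n N) \<longlonglongrightarrow> s N" and e: "\<And>N. (\<lambda>n. e n N) \<longlonglongrightarrow> t N"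
    and s: "s \<longlonglongrightarrow> L" and t: "t \<longlonglongrightarrow> 0"
  shows "p \<longlonglongrightarrow> L"
proof (rule LIMSEQ_I)
  fix \<epsilon> :: real assume \<epsilon>: "\<epsilon> > 0"
  \<comment> \<open>Four errors are added: \<open>S\<close> against \<open>s\<close>,
    \<open>s\<close> against \<open>L\<close>, \<open>e\<close> against \<open>t\<close>, and
    \<open>t\<close> against 0. Each gets a quarter of \<open>\<epsilon>\<close>.\<close>
  have "eventually (\<lambda>N. \<bar>s N - L\<bar> < \<epsilon> / 4) sequentially" "eventually (\<lambda>N. \<bar>t N - 0\<bar> < \<epsilon> / 4) sequentially"
    using tendstoD[OF s, of "\<epsilon> / 4"] tendstoD[OF t, of "\<epsilon> / 4"] \<epsilon> by (simp_all add: dist_real_def)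
  then have "eventually (\<lambda>N. \<bar>s N - L\<bar> < \<epsilon> / 4 \<and> \<bar>t N\<bar> < \<epsilon> / 4) sequentially"
    by eventually_elim auto
  then obtain N where N: "\<bar>s N - L\<bar> < \<epsilon> / 4" "\<bar>t N\<bar> < \<epsilon> / 4"
    by (auto simp: eventually_sequentially)
  have "eventually (\<lambda>n. \<bar>S n N - s N\<bar> < \<epsilon> / 4) sequentially"
    "eventually (\<lambda>n. \<bar>e n N - t N\<bar> < \<epsilon> / 4) sequentially"
    using tendstoD[OF S[of N], of "\<epsilon> / 4"] tendstoD[OF e[of N], of "\<epsilon> / 4"] \<epsilon> by (simp_all add: dist_real_def)
  then have "eventually (\<lambda>n. norm (p n - L) < \<epsilon>) sequentially"
  proof eventually_elim
    case (elim n)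
    then show ?case using N bound[of n N] unfolding real_norm_def abs_less_iff abs_le_iff by linarith
  qed
  then show "\<exists>no. \<forall>n\<ge>no. norm (p n - L) < \<epsilon>" by (simp add: eventually_sequentially)
qed

text \<open>The sequence \<open>b n m\<close> stands for a binomial moment. In the limit the
  truncated sums become partial sums of the exponential series at \<open>- \<mu>\<close>, scaled by
  \<open>\<mu> ^ j / fact j\<close>, and the error bounds become terms of the convergent series at
  \<open>\<mu>\<close>, which tend to 0.\<close>

lemma factorial_moments_poisson:
  fixes p :: "nat \<Rightarrow> real" and b :: "nat \<Rightarrow> nat \<Rightarrow> real"
  assumes bound: "\<And>n N. \<bar>p n - (\<Sum>i\<le>N. (-1) ^ i * real (j + i choose j) * b n (j + i))\<bar>
      \<le> real (j + Suc N choose j) * b n (j + Suc N)"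
    and b: "\<And>m. (\<lambda>n. b n m) \<longlonglongrightarrow> \<mu> ^ m / fact m"
  shows "p \<longlonglongrightarrow> \<mu> ^ j / fact j * exp (- \<mu>)"
proof (rule tendsto_truncation[OF bound])
  have fac: "real (j + i choose j) * (\<mu> ^ (j + i) / fact (j + i)) = \<mu> ^ j / fact j * (\<mu> ^ i / fact i)" for i
    by (simp add: binomial_fact power_add)
  show "(\<lambda>n. \<Sum>i\<le>N. (-1) ^ i * real (j + i choose j) * b n (j + i))
      \<longlonglongrightarrow> (\<Sum>i\<le>N. (-1) ^ i * real (j + i choose j) * (\<mu> ^ (j + i) / fact (j + i)))" for N
    by (intro tendsto_intros b)
  show "(\<lambda>n. real (j + Suc N choose j) * b n (j + Suc N))
      \<longlonglongrightarrow> real (j + Suc N choose j) * (\<mu> ^ (j + Suc N) / fact (j + Suc N))" for N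
    by (intro tendsto_intros b)
  have "(\<lambda>i. (- \<mu>) ^ i / fact i) sums exp (- \<mu>)"
    using exp_converges[of "- \<mu>"] by (simp add: scaleR_conv_of_real field_simps)
  then have "(\<lambda>N. \<Sum>i\<le>N. (- \<mu>) ^ i / fact i) \<longlonglongrightarrow> exp (- \<mu>)" by (simp add: sums_def_le)
  then have "(\<lambda>N. \<mu> ^ j / fact j * (\<Sum>i\<le>N. (- \<mu>) ^ i / fact i)) \<longlonglongrightarrow> \<mu> ^ j / fact j * exp (- \<mu>)"
    by (intro tendsto_intros)
  moreover have "(\<Sum>i\<le>N. (-1) ^ i * real (j + i choose j) * (\<mu> ^ (j + i) / fact (j + i)))
     = \<mu> ^ j / fact j * (\<Sum>i\<le>N. (- \<mu>) ^ i / fact i)" for N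
    unfolding sum_distrib_left mult.assoc fac
    by (intro sum.cong refl) (simp add: power_minus[of \<mu>])
  ultimately show "(\<lambda>N. \<Sum>i\<le>N. (-1) ^ i * real (j + i choose j) * (\<mu> ^ (j + i) / fact (j + i)))
      \<longlonglongrightarrow> \<mu> ^ j / fact j * exp (- \<mu>)" by simp
  have "summable (\<lambda>i. \<mu> ^ i / fact i)"
    using summable_exp[of \<mu>] by (simp add: field_simps)
  then have "(\<lambda>N. \<mu> ^ N / fact N) \<longlonglongrightarrow> 0" by (rule summable_LIMSEQ_zero)
  then have "(\<lambda>N. \<mu> ^ Suc N / fact (Suc N)) \<longlonglongrightarrow> 0" by (rule LIMSEQ_Suc)
  then have "(\<lambda>N. \<mu> ^ j / fact j * (\<mu> ^ Suc N / fact (Suc N))) \<longlonglongrightarrow> \<mu> ^ j / fact j * 0"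
    by (intro tendsto_intros)
  then show "(\<lambda>N. real (j + Suc N choose j) * (\<mu> ^ (j + Suc N) / fact (j + Suc N))) \<longlonglongrightarrow> 0"
    unfolding fac by simp
qed

section \<open>From point probabilities to weak convergence\<close>

lemma pmf_poisson_dist:
  assumes "\<mu> \<ge> 0"
  shows "pmf (poisson_dist \<mu>) j = \<mu> ^ j / fact j * exp (- \<mu>)"
  \<comment> \<open>At rate 0 the formula is the point mass at 0, because
    \<open>0 ^ 0 = 1\<close>.\<close>
  using assms by (cases "\<mu> = 0") (auto simp: poisson_dist_def indicator_def)

lemma cdf_distr_real_nat:
  assumes M: "prob_space M" and N: "N \<in> measurable M (count_space UNIV)"
  shows "cdf (distr M borel (\<lambda>\<omega>. real (N \<omega>))) x =
    (\<Sum>j\<in>{j. real j \<le> x}. measure M {\<omega> \<in> space M. N \<omega> = j})"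
proof -
  interpret prob_space M by fact
  have fin: "finite {j. real j \<le> x}"
  proof (rule finite_subset)
    show "{j. real j \<le> x} \<subseteq> {..nat \<lfloor>x\<rfloor>}" by (auto simp: le_nat_floor)
  qed simp
  have [measurable]: "N \<in> measurable M (count_space UNIV)" by fact
  have "cdf (distr M borel (\<lambda>\<omega>. real (N \<omega>))) x = measure M {\<omega> \<in> space M. real (N \<omega>) \<le> x}"
    unfolding cdf_def by (subst measure_distr) (auto intro!: arg_cong[where f = "measure M"])
  also have "{\<omega> \<in> space M. real (N \<omega>) \<le> x} = (\<Union>j\<in>{j. real j \<le> x}. {\<omega> \<in> space M. N \<omega> = j})" by auto
  also have "measure M \<dots> = (\<Sum>j\<in>{j. real j \<le> x}. measure M {\<omega> \<in> space M. N \<omega> = j})"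
    using fin by (intro finite_measure_finite_Union) (auto simp: disjoint_family_on_def)
  finally show ?thesis .
qed

text \<open>Only finitely many naturals lie below \<open>x\<close>, so the distribution function at
  \<open>x\<close> is a finite sum of point probabilities. It converges at every \<open>x\<close>,
  jumps included.\<close>

lemma weak_conv_m_nat:
  fixes q :: "nat pmf"
  assumes M: "\<And>n. prob_space (M n)" and N: "\<And>n. N n \<in> measurable (M n) (count_space UNIV)"
    and lim: "\<And>j. (\<lambda>n. measure (M n) {\<omega> \<in> space (M n). N n \<omega> = j}) \<longlonglongrightarrow> pmf q j"
  shows "weak_conv_m (\<lambda>n. distr (M n) borel (\<lambda>\<omega>. real (N n \<omega>))) (distr (measure_pmf q) borel real)"
  unfolding weak_conv_m_def weak_conv_def
proof (intro allI impI)
  fix x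
  have "cdf (distr (measure_pmf q) borel (\<lambda>j. real (id j))) x = (\<Sum>j\<in>{j. real j \<le> x}. pmf q j)"
    by (subst cdf_distr_real_nat) (auto simp: prob_space_measure_pmf pmf.rep_eq intro!: sum.cong arg_cong[where f = "measure _"])
  then show "(\<lambda>n. cdf (distr (M n) borel (\<lambda>\<omega>. real (N n \<omega>))) x) \<longlonglongrightarrow> cdf (distr (measure_pmf q) borel real) x"
    unfolding cdf_distr_real_nat[OF M N] by (simp add: tendsto_sum[OF lim])
qed

section \<open>The uniform measure on the circle\<close>

lemma dist_to_circle: "dist (to_circle s) (to_circle t) = torus_norm (s - t)"
  by transfer simp

lemma torus_norm_le_abs: "torus_norm t \<le> \<bar>t\<bar>"
  using torus_norm_le[of t 0] by simp

lemma surj_to_circle: "\<exists>t. x = to_circle t"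
  by (metis Quotient3_abs_rep Quotient3_circle)

lemma continuous_on_to_circle: "continuous_on A to_circle"
proof (rule continuous_onI)
  fix x e :: real assume "e > 0"
  then show "\<exists>d>0. \<forall>x'\<in>A. dist x' x < d \<longrightarrow> dist (to_circle x') (to_circle x) \<le> e"
    using torus_norm_le_abs
    by (intro exI[of _ e]) (auto simp: dist_to_circle dist_real_def intro: order_trans less_imp_le)
qed

text \<open>Second countability is what makes the distance of two random points measurable by
  \<open>borel_measurable_dist\<close>. The basis consists of the balls of radius
  \<open>1 / Suc n\<close> around images of rationals.\<close>

instance circle :: second_countable_topology
proof
  define Q where "Q = to_circle ` \<rat>"
  define B where "B = (\<lambda>(q, n). ball q (1 / real (Suc n))) ` (Q \<times> (UNIV :: nat set))"
  have "countable B" unfolding B_def Q_def by (intro countable_image countable_SIGMA countable_rat) auto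
  moreover have "topological_basis B"
  proof (rule topological_basisI)
    fix U assume "U \<in> B" then show "open U" by (auto simp: B_def)
  next
    fix U :: "circle set" and x assume U: "open U" "x \<in> U"
    then obtain e where e: "e > 0" "ball x e \<subseteq> U" by (meson open_contains_ball)
    obtain n where n: "1 / real (Suc n) < e / 2" using nat_approx_posE[of "e / 2"] e(1) by auto
    obtain t where t: "x = to_circle t" using surj_to_circle by blast
    obtain q where q: "q \<in> \<rat>" "t < q" "q < t + 1 / real (Suc n)"
      using Rats_dense_in_real[of t "t + 1 / real (Suc n)"] by auto
    have d: "dist (to_circle q) x < 1 / real (Suc n)"
      using q torus_norm_le_abs[of "q - t"] by (simp add: t dist_to_circle)
    have "ball (to_circle q) (1 / real (Suc n)) \<subseteq> ball x e"
    proof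
      fix y assume "y \<in> ball (to_circle q) (1 / real (Suc n))"
      then show "y \<in> ball x e"
        using d n dist_triangle[of x y "to_circle q"] by (simp add: dist_commute)
    qed
    then show "\<exists>B'\<in>B. x \<in> B' \<and> B' \<subseteq> U"
      using d e q by (intro bexI[of _ "ball (to_circle q) (1 / real (Suc n))"])
        (auto simp: B_def Q_def intro!: image_eqI[of _ _ "(to_circle q, n)"])
  qed
  then have "open = generate_topology B" by (rule topological_basis_imp_subbasis)
  ultimately show "\<exists>B::circle set set. countable B \<and> open = generate_topology B" by blast
qed

text \<open>Real representatives are used for the computations because they can be subtracted and
  reduced by \<open>frac\<close>; the law on the circle is the image of this one.\<close>

definition unit_uniform :: "real measure" where
  "unit_uniform = uniform_measure lborel {0..<1}"

lemma space_unit_uniform [simp]: "space unit_uniform = UNIV"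
  and sets_unit_uniform [measurable_cong, simp]: "sets unit_uniform = sets borel"
  by (simp_all add: unit_uniform_def)

lemma prob_space_unit_uniform: "prob_space unit_uniform"
  unfolding unit_uniform_def by (rule prob_space_uniform_measure) auto

lemma emeasure_unit_uniform: "A \<in> sets borel \<Longrightarrow> emeasure unit_uniform A = emeasure lborel ({0..<1} \<inter> A)"
  by (simp add: unit_uniform_def divide_ennreal_def)

lemma measurable_to_circle [measurable]: "to_circle \<in> borel_measurable borel"
  by (intro borel_measurable_continuous_onI continuous_on_to_circle)

lemma circle_uniform_eq: "circle_uniform = distr unit_uniform borel to_circle"
  by (simp add: circle_uniform_def unit_uniform_def)

lemma sets_circle_uniform [measurable_cong, simp]: "sets circle_uniform = sets borel"
  and space_circle_uniform [simp]: "space circle_uniform = UNIV"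
  by (simp_all add: circle_uniform_def)

lemma prob_space_circle_uniform: "prob_space circle_uniform"
  unfolding circle_uniform_eq
  by (intro prob_space.prob_space_distr prob_space_unit_uniform) simp

lemma frac_borel_measurable [measurable]: "(frac :: real \<Rightarrow> real) \<in> borel_measurable borel"
  unfolding frac_def by measurable

lemma emeasure_lborel_translate:
  fixes c :: real assumes [measurable]: "A \<in> sets borel"
  shows "emeasure lborel {y. y - c \<in> A} = emeasure lborel A"
proof -
  have "emeasure lborel A = emeasure (distr lborel borel ((+) (- c))) A"
    by (simp add: lborel_distr_plus)
  also have "\<dots> = emeasure lborel ((+) (- c) -` A)" by (subst emeasure_distr) auto
  also have "(+) (- c) -` A = {y. y - c \<in> A}" by auto
  finally show ?thesis by simp
qed

text \<open>Rotation invariance: cutting \<open>[0,1)\<close> at \<open>frac c\<close> leaves two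
  intervals, on each of which \<open>frac (y - c)\<close> is a translation. The translated pieces
  tile \<open>[0,1)\<close> again.\<close>

lemma emeasure_unit_uniform_rotate:
  assumes A [measurable]: "A \<in> sets borel"
  shows "emeasure unit_uniform {y. frac (y - c) \<in> A} = emeasure unit_uniform A"
proof -
  define c' where "c' = frac c"
  have c': "0 \<le> c'" "c' < 1" by (simp_all add: c'_def frac_ge_0 frac_lt_1)
  have fr: "frac (y - c) = frac (y - c')" for y :: real
  proof -
    have "y - c' = (y - c) + of_int \<lfloor>c\<rfloor>" by (simp add: c'_def frac_def)
    then show ?thesis unfolding frac_def by (simp only: floor_add_int[symmetric] of_int_add)
  qed
  have fr1: "frac (y - c') = y - c'" if "y \<in> {c'..<1}" for y
    using that c' by (subst frac_eq) auto
  have fr2: "frac (y - c') = y - (c' - 1)" if "y \<in> {0..<c'}" for y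
    using that c' by (subst frac_unique_iff) auto
  have "{0..<1} \<inter> {y. frac (y - c) \<in> A} =
      {y. y - c' \<in> A \<inter> {0..<1 - c'}} \<union> {y. y - (c' - 1) \<in> A \<inter> {1 - c'..<1}}"
    unfolding fr
  proof (intro equalityI subsetI)
    fix y assume y: "y \<in> {0..<1} \<inter> {y. frac (y - c') \<in> A}"
    then show "y \<in> {y. y - c' \<in> A \<inter> {0..<1 - c'}} \<union> {y. y - (c' - 1) \<in> A \<inter> {1 - c'..<1}}"
      using fr1[of y] fr2[of y] c' by (cases "c' \<le> y") auto
  next
    fix y assume "y \<in> {y. y - c' \<in> A \<inter> {0..<1 - c'}} \<union> {y. y - (c' - 1) \<in> A \<inter> {1 - c'..<1}}"
    then show "y \<in> {0..<1} \<inter> {y. frac (y - c') \<in> A}"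
      using fr1[of y] fr2[of y] c' by auto
  qed
  then have "emeasure unit_uniform {y. frac (y - c) \<in> A} =
      emeasure lborel ({y. y - c' \<in> A \<inter> {0..<1 - c'}} \<union> {y. y - (c' - 1) \<in> A \<inter> {1 - c'..<1}})"
    by (subst emeasure_unit_uniform) simp_all
  also have "\<dots> = emeasure lborel {y. y - c' \<in> A \<inter> {0..<1 - c'}} + emeasure lborel {y. y - (c' - 1) \<in> A \<inter> {1 - c'..<1}}"
    using c' by (intro plus_emeasure[symmetric]) auto
  also have "\<dots> = emeasure lborel (A \<inter> {0..<1 - c'}) + emeasure lborel (A \<inter> {1 - c'..<1})"
    by (subst (1 2) emeasure_lborel_translate) auto
  also have "\<dots> = emeasure lborel ((A \<inter> {0..<1 - c'}) \<union> (A \<inter> {1 - c'..<1}))"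
    by (intro plus_emeasure) auto
  also have "(A \<inter> {0..<1 - c'}) \<union> (A \<inter> {1 - c'..<1}) = {0..<1} \<inter> A" using c' by auto
  finally show ?thesis by (simp add: emeasure_unit_uniform)
qed

text \<open>Given the points in \<open>L\<close>, those in \<open>K\<close> are independent and uniform relative to their
  centres \<open>\<pi> i\<close>.\<close>

lemma emeasure_star:
  assumes "finite K" "finite L" "K \<inter> L = {}" "\<And>i. i \<in> K \<Longrightarrow> \<pi> i \<in> L"
    and A [measurable]: "\<And>i. i \<in> K \<Longrightarrow> A i \<in> sets borel"
  shows "emeasure (PiM (K \<union> L) (\<lambda>_. unit_uniform))
       {x \<in> space (PiM (K \<union> L) (\<lambda>_. unit_uniform)). \<forall>i\<in>K. frac (x i - x (\<pi> i)) \<in> A i}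
     = (\<Prod>i\<in>K. emeasure unit_uniform (A i))"
  using assms
proof (induction K)
  case empty
  interpret prob_space "PiM L (\<lambda>_. unit_uniform)"
    by (intro prob_space_PiM prob_space_unit_uniform)
  show ?case by (simp add: emeasure_space_1)
next
  case (insert j K)
  interpret prob_space unit_uniform by (rule prob_space_unit_uniform)
  interpret product_sigma_finite "\<lambda>_. unit_uniform" ..
  let ?P = "\<lambda>K. PiM (K \<union> L) (\<lambda>_. unit_uniform)"
  let ?E = "\<lambda>K. {x \<in> space (?P K). \<forall>i\<in>K. frac (x i - x (\<pi> i)) \<in> A i}"
  have j: "j \<notin> K \<union> L" and pj: "\<pi> j \<in> L" using insert by auto
  have meas: "?E K' \<in> sets (?P K')" if "K' \<subseteq> insert j K" for K'
  proof -
    have [measurable]: "(\<lambda>x. frac (x i - x (\<pi> i))) \<in> borel_measurable (?P K')" if "i \<in> K'" for i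
    proof -
      have "(\<lambda>x. x i) \<in> borel_measurable (?P K')" "(\<lambda>x. x (\<pi> i)) \<in> borel_measurable (?P K')"
        using that insert.prems(3)[of i] \<open>K' \<subseteq> insert j K\<close> by (auto intro!: measurable_PiM_component_rev)
      then show ?thesis by measurable
    qed
    have [measurable]: "A i \<in> sets borel" if "i \<in> K'" for i
      using that \<open>K' \<subseteq> insert j K\<close> insert.prems by auto
    have "finite K'" using that insert.hyps by (auto intro: finite_subset)
    then show ?thesis by measurable
  qed
  \<comment> \<open>Resampling the point \<open>j\<close> touches no other condition, as all centres
    lie in \<open>L\<close> and \<open>j\<close> does not.\<close>
  have split: "indicator (?E (insert j K)) (x(j := y)) =
      (indicator (?E K) x * indicator {y. frac (y - x (\<pi> j)) \<in> A j} y :: ennreal)"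
    if x: "x \<in> space (?P K)" for x y
  proof -
    have "x(j := y) \<in> space (?P (insert j K))"
      using x j by (auto simp: space_PiM PiE_def extensional_def)
    moreover have "frac ((x(j := y)) i - (x(j := y)) (\<pi> i)) = frac (x i - x (\<pi> i))" if "i \<in> K" for i
      using that j insert.prems(3)[of i] by auto
    moreover have "frac ((x(j := y)) j - (x(j := y)) (\<pi> j)) = frac (y - x (\<pi> j))"
      using j pj by auto
    ultimately show ?thesis using x by (auto simp: indicator_def simp del: fun_upd_apply)
  qed
  have "emeasure (?P (insert j K)) (?E (insert j K)) = (\<integral>\<^sup>+ x. indicator (?E (insert j K)) x \<partial>?P (insert j K))"
    using meas[of "insert j K"] by (subst nn_integral_indicator) auto
  also have "\<dots> = (\<integral>\<^sup>+ x. (\<integral>\<^sup>+ y. indicator (?E (insert j K)) (x(j := y)) \<partial>unit_uniform) \<partial>?P K)"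
    using insert.hyps insert.prems j meas[of "insert j K"] unfolding Un_insert_left
    by (subst product_nn_integral_insert) (auto intro!: borel_measurable_indicator)
  \<comment> \<open>With all other points fixed, the centre of \<open>j\<close> is a constant, so
    rotation invariance gives an inner integral that does not depend on it.\<close>
  also have "\<dots> = (\<integral>\<^sup>+ x. indicator (?E K) x * emeasure unit_uniform (A j) \<partial>?P K)"
  proof (rule nn_integral_cong)
    fix x assume x: "x \<in> space (?P K)"
    have [measurable]: "A j \<in> sets borel" using insert.prems by auto
    have "(\<integral>\<^sup>+ y. indicator (?E (insert j K)) (x(j := y)) \<partial>unit_uniform) =
       (\<integral>\<^sup>+ y. indicator (?E K) x * indicator {y. frac (y - x (\<pi> j)) \<in> A j} y \<partial>unit_uniform)"
      by (simp only: split[OF x])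
    also have "\<dots> = indicator (?E K) x * emeasure unit_uniform {y. frac (y - x (\<pi> j)) \<in> A j}"
      by (subst nn_integral_cmult_indicator) auto
    also have "emeasure unit_uniform {y. frac (y - x (\<pi> j)) \<in> A j} = emeasure unit_uniform (A j)"
      by (rule emeasure_unit_uniform_rotate) simp
    finally show "(\<integral>\<^sup>+ y. indicator (?E (insert j K)) (x(j := y)) \<partial>unit_uniform) =
      indicator (?E K) x * emeasure unit_uniform (A j)" .
  qed
  also have "\<dots> = emeasure (?P K) (?E K) * emeasure unit_uniform (A j)"
    using meas[OF subset_insertI] by (simp add: nn_integral_multc)
  also have "emeasure (?P K) (?E K) = (\<Prod>i\<in>K. emeasure unit_uniform (A i))"
    using insert by auto
  finally show ?case using insert.hyps by (simp add: mult.commute)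
qed

section \<open>Cliques of random points on the circle\<close>

text \<open>A leader is a counterclockwise-first point of the clique; ties between coinciding points are
  broken in favour of the smaller index, so that leaders are unique everywhere and not just almost
  surely.\<close>

definition leader :: "real \<Rightarrow> ('a::linorder \<Rightarrow> real) \<Rightarrow> 'a set \<Rightarrow> 'a \<Rightarrow> bool" where
  "leader r x S j \<longleftrightarrow> (\<forall>i\<in>S - {j}. frac (x i - x j) \<in> (if i < j then {0<..r} else {0..r}))"

text \<open>A leader places the whole set on an arc of length \<open>r\<close> that starts at it.
  Conversely, \<open>r < 1/3\<close> lets the clique be unrolled onto the real line without changing
  distances, where it has a smallest point.\<close>

lemma clique_iff_leader:
  assumes S: "finite S" "S \<noteq> {}" and r: "0 \<le> r" "r < 1/3"
  shows "(\<forall>i\<in>S. \<forall>j\<in>S. torus_norm (x i - x j) \<le> r) \<longleftrightarrow> (\<exists>j\<in>S. leader r x S j)"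
proof
  assume "\<exists>j\<in>S. leader r x S j"
  then obtain j where j: "j \<in> S" "leader r x S j" by blast
  have f: "frac (x i - x j) \<in> {0..r}" if "i \<in> S" for i
    using j that r by (cases "i = j") (auto simp: leader_def split: if_splits)
  show "\<forall>i\<in>S. \<forall>j\<in>S. torus_norm (x i - x j) \<le> r"
  proof (intro ballI)
    fix i i' assume i: "i \<in> S" "i' \<in> S"
    have "torus_norm (x i - x i') = torus_norm (frac (x i - x j) - frac (x i' - x j))"
      by (rule torus_norm_cong) (auto simp: frac_def)
    also have "\<dots> \<le> \<bar>frac (x i - x j) - frac (x i' - x j)\<bar>" by (rule torus_norm_le_abs)
    also have "\<dots> \<le> r" using f[OF i(1)] f[OF i(2)] unfolding atLeastAtMost_iff by linarith
    finally show "torus_norm (x i - x i') \<le> r" .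
  qed
next
  assume cl: "\<forall>i\<in>S. \<forall>j\<in>S. torus_norm (x i - x j) \<le> r"
  obtain s where s: "s \<in> S" using S by blast
  \<comment> \<open>The clique is unrolled around one of its points \<open>s\<close>; all lifts lie
    in \<open>[-r, r]\<close>.\<close>
  define z where "z i = (x i - x s) - of_int (round (x i - x s))" for i
  have zr: "\<bar>z i\<bar> \<le> r" if "i \<in> S" for i
    using cl that s by (simp add: z_def torus_norm_round)
  have zint: "(x i - x j) - (z i - z j) \<in> \<int>" for i j by (simp add: z_def)
  have dz: "\<bar>z i - z j\<bar> \<le> r" if "i \<in> S" "j \<in> S" for i j
  proof -
    define t where "t = z i - z j"
    have t2: "\<bar>t\<bar> \<le> 2 * r" using zr[OF that(1)] zr[OF that(2)] by (simp add: t_def)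
    have "torus_norm t \<le> r" using cl[rule_format, OF that] torus_norm_cong[OF zint[of i j]] by (simp add: t_def)
    then have t: "\<bar>t - of_int (round t)\<bar> \<le> r" by (simp add: torus_norm_round)
    \<comment> \<open>A nonzero nearest integer would give
      \<open>\<bar>t\<bar> \<ge> 1 - r > 2 * r\<close>; this is where 1/3 enters.\<close>
    have "round t = 0"
    proof (rule ccontr)
      assume "round t \<noteq> 0"
      then have "\<bar>real_of_int (round t)\<bar> \<ge> 1" by linarith
      then show False using t t2 r by linarith
    qed
    with t show ?thesis by (simp add: t_def)
  qed
  \<comment> \<open>Several points may share the smallest lift; the leader is the one of smallest
    index among them.\<close>
  define T where "T = {i \<in> S. z i = Min (z ` S)}"
  have finT: "finite T" using S by (simp add: T_def)
  have "Min (z ` S) \<in> z ` S" using S by (intro Min_in) auto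
  then have "T \<noteq> {}" by (auto simp: T_def)
  with finT have jT: "Min T \<in> T" by (rule Min_in)
  define j where "j = Min T"
  have jS: "j \<in> S" and jm: "z j = Min (z ` S)" using jT by (auto simp: T_def j_def)
  have "leader r x S j"
    unfolding leader_def
  proof
    fix i assume i: "i \<in> S - {j}"
    have ge: "z j \<le> z i" using i S by (simp add: jm)
    have gt: "z j < z i" if "i < j"
    proof -
      have "i \<notin> T" using Min_le[OF finT, of i] that by (auto simp: j_def)
      then show ?thesis using ge i jm by (auto simp: T_def)
    qed
    have "frac (x i - x j) = z i - z j"
      using zint[of i j] ge dz[of i j] i jS r by (subst frac_unique_iff) auto
    then show "frac (x i - x j) \<in> (if i < j then {0<..r} else {0..r})"
      using ge gt dz[of i j] i jS by auto
  qed
  with jS show "\<exists>j\<in>S. leader r x S j" by blast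
qed

text \<open>For two leaders \<open>a < b\<close>, the tie-breaking rule makes
  \<open>frac (x a - x b)\<close> positive, so it and \<open>frac (x b - x a)\<close> add up to 1.
  Both are at most \<open>r\<close>, which is too small.\<close>

lemma leader_unique:
  assumes r: "r < 1/3" and j: "j \<in> S" "leader r x S j" and j': "j' \<in> S" "leader r x S j'"
  shows "j = j'"
proof -
  have False if "a < b" "a \<in> S" "b \<in> S" "leader r x S a" "leader r x S b" for a b
  proof -
    have 1: "frac (x a - x b) \<in> {0<..r}" and 2: "frac (x b - x a) \<in> {0..r}"
      using that by (auto simp: leader_def split: if_splits)
    have "frac (x b - x a) = 1 - frac (x a - x b)"
      using 1 frac_neg[of "x a - x b"] by (auto split: if_splits)
    with 1 2 r show False by auto
  qed
  from this[of j j'] this[of j' j] show ?thesis using j j' by (meson linorder_less_linear)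
qed

lemma emeasure_unit_uniform_Icc:
  assumes "0 \<le> r" "r < 1"
  shows "emeasure unit_uniform (if b then {0<..r} else {0..r}) = ennreal r"
proof -
  have "{0..<1} \<inter> {0<..r} = {0<..r}" "{0..<1} \<inter> {0..r} = {0..r}" using assms by auto
  then show ?thesis using assms by (simp add: emeasure_unit_uniform)
qed

text \<open>In the fundamental domain a neighbourhood of 0 has two pieces, one at each end of the
  interval, hence the factor 2.\<close>

lemma emeasure_unit_uniform_near:
  assumes "0 \<le> s"
  shows "emeasure unit_uniform {t. torus_norm t \<le> s} \<le> ennreal (2 * s)"
proof -
  have "{0..<1} \<inter> {t. torus_norm t \<le> s} \<subseteq> {0..s} \<union> {1 - s..1}"
  proof
    fix t assume t: "t \<in> {0..<1} \<inter> {t. torus_norm t \<le> s}"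
    then have "round t = 0 \<or> round t = 1" unfolding round_def by (auto simp: floor_eq_iff)
    with t show "t \<in> {0..s} \<union> {1 - s..1}" by (auto simp: torus_norm_round)
  qed
  moreover have "{t. torus_norm t \<le> s} \<in> sets borel"
    unfolding torus_norm_round round_def by measurable
  ultimately have "emeasure unit_uniform {t. torus_norm t \<le> s} \<le> emeasure lborel ({0..s} \<union> {1 - s..1})"
    by (subst emeasure_unit_uniform) (auto intro!: emeasure_mono)
  also have "\<dots> \<le> emeasure lborel {0..s} + emeasure lborel {1 - s..1}"
    by (rule emeasure_subadditive) auto
  also have "\<dots> = ennreal (2 * s)"
    using assms by (simp add: ennreal_plus[symmetric] del: ennreal_plus)
  finally show ?thesis .
qed

section \<open>Probability that all members of a packing are cliques\<close>

lemma packing_block: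
  assumes "F \<in> packings k m V"
  shows "\<exists>\<beta>. \<forall>S\<in>F. \<forall>i\<in>S. \<beta> i = S"
proof (intro exI ballI)
  fix S i assume "S \<in> F" "i \<in> S"
  then show "(THE S. S \<in> F \<and> i \<in> S) = S"
    using assms by (intro the_equality) (auto simp: packings_def disjoint_def)
qed

text \<open>The event splits according to the leader of each member. There are \<open>k ^ m\<close>
  choices, mutually exclusive by uniqueness of leaders, and each prescribes the position of
  \<open>m * (k - 1)\<close> points relative to their leaders, at cost \<open>r\<close> per
  point.\<close>

lemma emeasure_cliques:
  fixes V :: "nat set"
  assumes V: "finite V" and F: "F \<in> packings k m V" and k: "k \<ge> 1" and r: "0 \<le> r" "r < 1/3"
  shows "emeasure (PiM V (\<lambda>_. unit_uniform))
      {x \<in> space (PiM V (\<lambda>_. unit_uniform)). \<forall>S\<in>F. \<forall>i\<in>S. \<forall>j\<in>S. torus_norm (x i - x j) \<le> r}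
    = ennreal ((real k * r ^ (k - 1)) ^ m)"
proof -
  let ?P = "PiM V (\<lambda>_. unit_uniform)"
  define E where "E h = {x \<in> space ?P. \<forall>S\<in>F. leader r x S (h S)}" for h :: "nat set \<Rightarrow> nat"
  \<comment> \<open>Extensional choice functions: there are exactly \<open>k ^ m\<close> of them,
    and two that agree on \<open>F\<close> are equal.\<close>
  define \<H> where "\<H> = PiE F (\<lambda>S. S)"
  have finF: "finite F" and cardF: "card F = m"
    and FS: "\<And>S. S \<in> F \<Longrightarrow> S \<subseteq> V \<and> card S = k" and disj: "disjoint F"
    using F by (auto simp: packings_def)
  have S: "finite S" "S \<noteq> {}" if "S \<in> F" for S
    using FS[OF that] V k by (auto intro: finite_subset)
  obtain \<beta> where \<beta>: "\<And>S i. S \<in> F \<Longrightarrow> i \<in> S \<Longrightarrow> \<beta> i = S" using packing_block[OF F] by blast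
  have star: "E h \<in> sets ?P \<and> emeasure ?P (E h) = ennreal r ^ (m * (k - 1))" if h: "h \<in> \<H>" for h
  proof -
    have hS: "h S \<in> S" if "S \<in> F" for S using h that by (auto simp: \<H>_def)
    \<comment> \<open>The followers: every point of the packing that is not the chosen leader of its
      block. The centre \<open>\<pi> i\<close> of a follower is the leader of its block.\<close>
    define K where "K = \<Union>F - h ` F"
    define \<pi> where "\<pi> i = h (\<beta> i)" for i
    define A where "A i = (if i < \<pi> i then {0<..r} else {0..r})" for i
    have KV: "K \<subseteq> V" using FS by (auto simp: K_def)
    have finK: "finite K" using KV V by (rule finite_subset)
    have inj: "inj_on h F" by (rule inj_onI) (metis hS \<beta>)
    have K_iff: "(\<forall>S\<in>F. \<forall>i\<in>S - {h S}. Q i) \<longleftrightarrow> (\<forall>i\<in>K. Q i)" for Q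
    proof -
      have "i \<in> K \<longleftrightarrow> (\<exists>S\<in>F. i \<in> S - {h S})" for i
      proof
        assume "\<exists>S\<in>F. i \<in> S - {h S}"
        then obtain S where S: "S \<in> F" "i \<in> S" "i \<noteq> h S" by blast
        have "i \<noteq> h T" if "T \<in> F" for T
          using \<beta>[OF S(1,2)] \<beta>[OF that hS[OF that]] S(3) by auto
        with S show "i \<in> K" by (auto simp: K_def)
      qed (auto simp: K_def)
      then show ?thesis by blast
    qed
    have "leader r x S (h S) \<longleftrightarrow> (\<forall>i\<in>S - {h S}. frac (x i - x (\<pi> i)) \<in> A i)" if "S \<in> F" for x S
      unfolding leader_def using \<beta>[OF that] by (simp add: A_def \<pi>_def)
    then have E: "E h = {x \<in> space ?P. \<forall>i\<in>K. frac (x i - x (\<pi> i)) \<in> A i}"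
      unfolding E_def K_iff[symmetric] by auto
    have \<pi>: "\<pi> i \<in> V - K" if iK: "i \<in> K" for i
    proof -
      obtain S where "S \<in> F" "i \<in> S" using iK by (auto simp: K_def)
      then show ?thesis using hS[of S] FS[of S] \<beta>[of S i] by (auto simp: \<pi>_def K_def)
    qed
    have A [measurable]: "A i \<in> sets borel" for i by (simp add: A_def)
    have "E h \<in> sets ?P"
    proof -
      have [measurable]: "(\<lambda>x. frac (x i - x (\<pi> i))) \<in> borel_measurable ?P" if "i \<in> K" for i
      proof -
        have "(\<lambda>x. x i) \<in> borel_measurable ?P" "(\<lambda>x. x (\<pi> i)) \<in> borel_measurable ?P"
          using that KV \<pi> by (auto intro!: measurable_PiM_component_rev)
        then show ?thesis by measurable
      qed
      show ?thesis unfolding E using finK by measurable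
    qed
    \<comment> \<open>The set \<open>V - K\<close> of free points contains the leaders and
      everything outside the packing.\<close>
    moreover have "emeasure ?P (E h) = (\<Prod>i\<in>K. emeasure unit_uniform (A i))"
      using emeasure_star[of K "V - K" \<pi> A] finK V \<pi> KV by (simp add: E Un_absorb1)
    moreover have "emeasure unit_uniform (A i) = ennreal r" for i
      unfolding A_def using r by (intro emeasure_unit_uniform_Icc) auto
    moreover have "card K = m * (k - 1)"
    proof -
      have "card K = card (\<Union>F) - card (h ` F)"
        unfolding K_def using finF hS by (intro card_Diff_subset) auto
      then show ?thesis
        using card_Union_packing(1)[OF F V] card_image[OF inj] cardF by (simp add: diff_mult_distrib2 mult.commute)
    qed
    ultimately show ?thesis by simp
  qed
  have "{x \<in> space ?P. \<forall>S\<in>F. \<forall>i\<in>S. \<forall>j\<in>S. torus_norm (x i - x j) \<le> r} = (\<Union>h\<in>\<H>. E h)"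
  proof -
    have "(\<forall>S\<in>F. \<forall>i\<in>S. \<forall>j\<in>S. torus_norm (x i - x j) \<le> r) \<longleftrightarrow> (\<forall>S\<in>F. \<exists>j\<in>S. leader r x S j)" for x
      by (intro ball_cong refl clique_iff_leader[OF S r])
    moreover have "(\<forall>S\<in>F. \<exists>j\<in>S. leader r x S j) \<longleftrightarrow> (\<exists>h\<in>\<H>. \<forall>S\<in>F. leader r x S (h S))" for x
    proof
      assume "\<forall>S\<in>F. \<exists>j\<in>S. leader r x S j"
      then obtain g where "\<forall>S\<in>F. g S \<in> S \<and> leader r x S (g S)" by metis
      then show "\<exists>h\<in>\<H>. \<forall>S\<in>F. leader r x S (h S)"
        by (intro bexI[of _ "restrict g F"]) (auto simp: \<H>_def)
    qed (auto simp: \<H>_def)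
    ultimately show ?thesis by (auto simp: E_def)
  qed
  also have "emeasure ?P (\<Union>h\<in>\<H>. E h) = (\<Sum>h\<in>\<H>. emeasure ?P (E h))"
  proof (rule sum_emeasure[symmetric])
    show "E ` \<H> \<subseteq> sets ?P" using star by blast
    show "finite \<H>" unfolding \<H>_def using finF S by (intro finite_PiE) auto
    show "disjoint_family_on E \<H>"
      unfolding disjoint_family_on_def
    proof (intro ballI impI)
      fix h h' assume l: "h \<in> \<H>" "h' \<in> \<H>" "h \<noteq> h'"
      show "E h \<inter> E h' = {}"
      proof (rule ccontr)
        assume "E h \<inter> E h' \<noteq> {}"
        then obtain x where x: "\<forall>S\<in>F. leader r x S (h S)" "\<forall>S\<in>F. leader r x S (h' S)"
          by (auto simp: E_def)
        have "h S = h' S" if "S \<in> F" for S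
          using l x that by (intro leader_unique[OF r(2), of _ S x]) (auto simp: \<H>_def)
        with l show False unfolding \<H>_def by (metis PiE_ext)
      qed
    qed
  qed
  also have "\<dots> = (\<Sum>h\<in>\<H>. ennreal r ^ (m * (k - 1)))" using star by simp
  also have "\<dots> = of_nat (k ^ m) * ennreal r ^ (m * (k - 1))"
    using finF FS cardF by (simp add: \<H>_def card_PiE)
  also have "\<dots> = ennreal (real (k ^ m)) * ennreal (r ^ (m * (k - 1)))"
    by (simp only: ennreal_of_nat_eq_real_of_nat ennreal_power[OF r(1)])
  also have "\<dots> = ennreal (real (k ^ m) * r ^ (m * (k - 1)))"
    using r by (subst ennreal_mult) auto
  also have "real (k ^ m) * r ^ (m * (k - 1)) = (real k * r ^ (k - 1)) ^ m"
    by (simp add: power_mult_distrib power_mult mult.commute[of m])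
  finally show ?thesis .
qed

text \<open>The edge lets \<open>v\<close> replace a point of \<open>S\<close> as the centre of \<open>S\<close>, at the price of doubling the
  radius; this saves one centre compared with the bare cliques.\<close>

lemma emeasure_cliques_edge:
  fixes V :: "nat set"
  assumes V: "finite V" and F: "F \<in> packings k m V" and k: "k \<ge> 1" and r: "0 \<le> r"
    and S: "S \<in> F" and u: "u \<in> S" and v: "v \<in> V - S"
  shows "emeasure (PiM V (\<lambda>_. unit_uniform))
      {x \<in> space (PiM V (\<lambda>_. unit_uniform)).
        (\<forall>S\<in>F. \<forall>i\<in>S. \<forall>j\<in>S. torus_norm (x i - x j) \<le> r) \<and> torus_norm (x u - x v) \<le> r}
    \<le> ennreal ((4 * r) ^ (m * (k - 1) + 1))"
    (is "emeasure ?P ?E \<le> _")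
proof -
  have finF: "finite F" and cardF: "card F = m"
    and FS: "\<And>S. S \<in> F \<Longrightarrow> S \<subseteq> V \<and> card S = k"
    using F by (auto simp: packings_def)
  have ne: "T \<noteq> {}" if "T \<in> F" for T using FS[OF that] k by auto
  obtain \<beta> where \<beta>: "\<And>S i. S \<in> F \<Longrightarrow> i \<in> S \<Longrightarrow> \<beta> i = S" using packing_block[OF F] by blast
  \<comment> \<open>If \<open>v\<close> lies in another member, it must be the centre there as well;
    otherwise the centre of \<open>S\<close> would itself be a constrained point.\<close>
  define c where "c T = (if v \<in> T then v else SOME i. i \<in> T)" for T
  have c: "c T \<in> T" if "T \<in> F" for T
    using some_in_eq[of T] ne[OF that] by (simp add: c_def)
  \<comment> \<open>No point of \<open>S\<close> is removed, since its centre \<open>v\<close> is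
    outside \<open>S\<close>; every other member loses its own centre.\<close>
  define K where "K = \<Union>F - c ` (F - {S})"
  define \<pi> where "\<pi> i = (if \<beta> i = S then v else c (\<beta> i))" for i
  \<comment> \<open>A point of \<open>S\<close> reaches \<open>v\<close> through \<open>u\<close>,
    hence the radius \<open>2 * r\<close> and a measure of at most \<open>4 * r\<close>.\<close>
  define A where "A = (\<lambda>_ :: nat. {t. torus_norm t \<le> 2 * r})"
  have A: "A i \<in> sets borel" for i
    unfolding A_def torus_norm_round round_def by measurable
  have KV: "K \<subseteq> V" using FS by (auto simp: K_def)
  have finK: "finite K" using KV V by (rule finite_subset)
  have vK: "v \<notin> K"
  proof
    assume "v \<in> K"
    then obtain T where T: "T \<in> F" "v \<in> T" by (auto simp: K_def)
    moreover have "T \<noteq> S" using T v by auto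
    ultimately have "v \<in> c ` (F - {S})" by (auto simp: c_def intro!: image_eqI[of _ _ T])
    with \<open>v \<in> K\<close> show False by (simp add: K_def)
  qed
  have \<pi>: "\<pi> i \<in> V - K" if iK: "i \<in> K" for i
  proof -
    obtain T where T: "T \<in> F" "i \<in> T" using iK by (auto simp: K_def)
    show ?thesis
    proof (cases "T = S")
      case True then show ?thesis using v vK \<beta>[OF T] by (simp add: \<pi>_def)
    next
      case False
      then show ?thesis using c[OF T(1)] FS[OF T(1)] \<beta>[OF T] T by (auto simp: \<pi>_def K_def)
    qed
  qed
  \<comment> \<open>The packing has \<open>k * m\<close> points, and \<open>m - 1\<close> of them
    are centres.\<close>
  have "card K = m * (k - 1) + 1"
  proof -
    have inj: "inj_on c (F - {S})" using c \<beta> by (metis DiffD1 inj_onI)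
    have "card K = card (\<Union>F) - card (c ` (F - {S}))"
      unfolding K_def using finF c by (intro card_Diff_subset) auto
    moreover have "m \<ge> 1" using S cardF finF by (metis One_nat_def Suc_leI card_gt_0_iff empty_iff)
    ultimately show ?thesis
      using card_Union_packing(1)[OF F V] card_image[OF inj] cardF S finF k
      by (cases m; cases k) auto
  qed
  have sub: "?E \<subseteq> {x \<in> space ?P. \<forall>i\<in>K. frac (x i - x (\<pi> i)) \<in> A i}"
  proof safe
    fix x i
    assume cl: "\<forall>S\<in>F. \<forall>i\<in>S. \<forall>j\<in>S. torus_norm (x i - x j) \<le> r" and uv: "torus_norm (x u - x v) \<le> r"
      and i: "i \<in> K"
    obtain T where T: "T \<in> F" "i \<in> T" using i by (auto simp: K_def)
    have "torus_norm (x i - x (\<pi> i)) \<le> 2 * r"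
    proof (cases "T = S")
      case True
      have "torus_norm (x i - x v) \<le> torus_norm (x i - x u) + torus_norm (x u - x v)"
        using torus_norm_triangle[of "x i - x u" "x u - x v"] by simp
      moreover have "torus_norm (x i - x u) \<le> r" using cl S T True u by blast
      ultimately show ?thesis using uv \<beta>[OF T] True by (simp add: \<pi>_def)
    next
      case False
      then have "torus_norm (x i - x (\<pi> i)) \<le> r" using cl T c \<beta>[OF T] by (simp add: \<pi>_def)
      then show ?thesis using r by simp
    qed
    moreover have "torus_norm (frac (x i - x (\<pi> i))) = torus_norm (x i - x (\<pi> i))"
      by (rule torus_norm_cong) (simp add: frac_def)
    ultimately show "frac (x i - x (\<pi> i)) \<in> A i" by (simp add: A_def)
  qed
  have "{x \<in> space ?P. \<forall>i\<in>K. frac (x i - x (\<pi> i)) \<in> A i} \<in> sets ?P"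
  proof -
    have [measurable]: "(\<lambda>x. frac (x i - x (\<pi> i))) \<in> borel_measurable ?P" if "i \<in> K" for i
    proof -
      have "(\<lambda>x. x i) \<in> borel_measurable ?P" "(\<lambda>x. x (\<pi> i)) \<in> borel_measurable ?P"
        using that KV \<pi> by (auto intro!: measurable_PiM_component_rev)
      then show ?thesis by measurable
    qed
    show ?thesis using finK A by measurable
  qed
  with sub have "emeasure ?P ?E \<le> emeasure ?P {x \<in> space ?P. \<forall>i\<in>K. frac (x i - x (\<pi> i)) \<in> A i}"
    by (intro emeasure_mono)
  also have "\<dots> = (\<Prod>i\<in>K. emeasure unit_uniform (A i))"
    using emeasure_star[of K "V - K" \<pi> A] finK V \<pi> KV A by (simp add: Un_absorb1)
  also have "\<dots> \<le> (\<Prod>i\<in>K. ennreal (4 * r))"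
    using finK emeasure_unit_uniform_near[of "2 * r"] r
    by (induction K rule: finite_induct) (auto simp: A_def intro!: mult_mono)
  also have "\<dots> = ennreal ((4 * r) ^ (m * (k - 1) + 1))"
    unfolding prod_constant \<open>card K = _\<close> using r by (intro ennreal_power) simp
  finally show ?thesis .
qed

section \<open>From the circle to the torus\<close>

text \<open>As \<open>g\<close> is injective, the rows read off disjoint sets of independent
  coordinates, so they are independent with product laws. The indexing \<open>g\<close> is arbitrary
  so that one array can be read both by rows and by columns.\<close>

lemma distr_PiM_curry:
  fixes g :: "'i \<Rightarrow> 'j \<Rightarrow> 'l"
  assumes N: "prob_space N" and I: "I \<noteq> {}" and J: "J \<noteq> {}"
    and inj: "inj_on (\<lambda>(i, j). g i j) (I \<times> J)" and L: "\<And>i j. i \<in> I \<Longrightarrow> j \<in> J \<Longrightarrow> g i j \<in> L"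
  shows "distr (PiM L (\<lambda>_. N)) (PiM I (\<lambda>_. PiM J (\<lambda>_. N))) (\<lambda>\<omega>. \<lambda>i\<in>I. \<lambda>j\<in>J. \<omega> (g i j))
    = PiM I (\<lambda>_. PiM J (\<lambda>_. N))"
proof -
  interpret P: prob_space "PiM L (\<lambda>_. N)" by (intro prob_space_PiM N)
  have law: "distr (PiM L (\<lambda>_. N)) (PiM J (\<lambda>_. N)) (\<lambda>\<omega>. \<lambda>j\<in>J. \<omega> (g i j)) = PiM J (\<lambda>_. N)"
    if "i \<in> I" for i
    using inj that L by (intro distr_PiM_reindex[where M = "\<lambda>_. N"] N) (auto simp: inj_on_def)
  have meas: "(\<lambda>\<omega>. \<lambda>j\<in>J. \<omega> (g i j)) \<in> measurable (PiM L (\<lambda>_. N)) (PiM J (\<lambda>_. N))" if "i \<in> I" for i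
    using L that by (intro measurable_restrict measurable_component_singleton)
  have "L \<noteq> {}" using I J L by blast
  then have "P.indep_vars (\<lambda>_. N) (\<lambda>l \<omega>. \<omega> l) L"
    using N by (subst P.indep_vars_iff_distr_eq_PiM')
      (auto simp: distr_PiM_component[where M = "\<lambda>_. N"] restrict_def[symmetric] cong: PiM_cong
        intro!: distr_PiM_reindex[where M = "\<lambda>_. N" and f = "\<lambda>i. i", simplified])
  then have "P.indep_vars (\<lambda>i. PiM (g i ` J) (\<lambda>_. N)) (\<lambda>i \<omega>. restrict (\<lambda>l. \<omega> l) (g i ` J)) I"
    using inj L by (intro P.indep_vars_restrict) (auto simp: disjoint_family_on_def inj_on_def)
  then have "P.indep_vars (\<lambda>_. PiM J (\<lambda>_. N)) (\<lambda>i \<omega>. (\<lambda>y. \<lambda>j\<in>J. y (g i j)) (restrict (\<lambda>l. \<omega> l) (g i ` J))) I"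
  proof (rule P.indep_vars_compose2)
    show "(\<lambda>y. \<lambda>j\<in>J. y (g i j)) \<in> measurable (PiM (g i ` J) (\<lambda>_. N)) (PiM J (\<lambda>_. N))" for i
      by (intro measurable_restrict measurable_component_singleton) auto
  qed
  also have "(\<lambda>i \<omega>. (\<lambda>y. \<lambda>j\<in>J. y (g i j)) (restrict (\<lambda>l. \<omega> l) (g i ` J))) =
      (\<lambda>i \<omega>. \<lambda>j\<in>J. \<omega> (g i j))"
    by (auto simp: fun_eq_iff restrict_def)
  finally have ind: "P.indep_vars (\<lambda>_. PiM J (\<lambda>_. N)) (\<lambda>i \<omega>. \<lambda>j\<in>J. \<omega> (g i j)) I" .
  have "distr (PiM L (\<lambda>_. N)) (PiM I (\<lambda>_. PiM J (\<lambda>_. N))) (\<lambda>\<omega>. \<lambda>i\<in>I. \<lambda>j\<in>J. \<omega> (g i j))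
    = PiM I (\<lambda>i. distr (PiM L (\<lambda>_. N)) (PiM J (\<lambda>_. N)) (\<lambda>\<omega>. \<lambda>j\<in>J. \<omega> (g i j)))"
    using ind I meas by (subst (asm) P.indep_vars_iff_distr_eq_PiM') auto
  then show ?thesis using law by (simp cong: PiM_cong)
qed

text \<open>Transposition: both nested products are images of the product over
  \<open>I \<times> J\<close>. Grouped by \<open>j\<close> instead of \<open>i\<close>, the event
  asks the same of each of \<open>card J\<close> independent columns.\<close>

lemma emeasure_PiM_PiM_coordinatewise:
  assumes N: "prob_space N" and IJ: "finite I" "finite J" "I \<noteq> {}" "J \<noteq> {}"
    and A [measurable]: "A \<in> sets (PiM I (\<lambda>_. N))"
  shows "emeasure (PiM I (\<lambda>_. PiM J (\<lambda>_. N)))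
      {x \<in> space (PiM I (\<lambda>_. PiM J (\<lambda>_. N))). \<forall>j\<in>J. (\<lambda>i\<in>I. x i j) \<in> A}
    = emeasure (PiM I (\<lambda>_. N)) A ^ card J"
proof -
  let ?L = "PiM (I \<times> J) (\<lambda>_. N)"
  let ?E = "{x \<in> space (PiM I (\<lambda>_. PiM J (\<lambda>_. N))). \<forall>j\<in>J. (\<lambda>i\<in>I. x i j) \<in> A}"
  let ?f = "\<lambda>\<omega>. \<lambda>i\<in>I. \<lambda>j\<in>J. \<omega> (i, j)" and ?h = "\<lambda>\<omega>. \<lambda>j\<in>J. \<lambda>i\<in>I. \<omega> (i, j)"
  have f [measurable]: "?f \<in> measurable ?L (PiM I (\<lambda>_. PiM J (\<lambda>_. N)))"
    by (intro measurable_restrict measurable_component_singleton) auto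
  have h [measurable]: "?h \<in> measurable ?L (PiM J (\<lambda>_. PiM I (\<lambda>_. N)))"
    by (intro measurable_restrict measurable_component_singleton) auto
  have E: "?E \<in> sets (PiM I (\<lambda>_. PiM J (\<lambda>_. N)))"
  proof -
    have [measurable]: "(\<lambda>x. \<lambda>i\<in>I. x i j) \<in> measurable (PiM I (\<lambda>_. PiM J (\<lambda>_. N))) (PiM I (\<lambda>_. N))"
      if "j \<in> J" for j
      using that by (intro measurable_restrict measurable_PiM_component_rev[where f = "\<lambda>y. y j"] measurable_component_singleton)
    show ?thesis using IJ by measurable
  qed
  have B: "PiE J (\<lambda>_. A) \<in> sets (PiM J (\<lambda>_. PiM I (\<lambda>_. N)))"
    using IJ by (intro sets_PiM_I_finite) auto
  interpret N: prob_space "PiM I (\<lambda>_. N)" by (intro prob_space_PiM N)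
  interpret product_sigma_finite "\<lambda>_. PiM I (\<lambda>_. N)" ..
  have vimage: "?f -` ?E \<inter> space ?L = ?h -` PiE J (\<lambda>_. A) \<inter> space ?L"
  proof (intro set_eqI)
    fix \<omega>
    have "?f \<omega> \<in> space (PiM I (\<lambda>_. PiM J (\<lambda>_. N)))" if "\<omega> \<in> space ?L"
      using f that by (rule measurable_space)
    moreover have "(\<lambda>i\<in>I. ?f \<omega> i j) = (\<lambda>i\<in>I. \<omega> (i, j))" if "j \<in> J" for j
      using that by auto
    ultimately show "\<omega> \<in> ?f -` ?E \<inter> space ?L \<longleftrightarrow> \<omega> \<in> ?h -` PiE J (\<lambda>_. A) \<inter> space ?L"
      by (auto simp: restrict_PiE_iff simp del: restrict_apply)
  qed
  have "emeasure (PiM I (\<lambda>_. PiM J (\<lambda>_. N))) ?E = emeasure (distr ?L (PiM I (\<lambda>_. PiM J (\<lambda>_. N))) ?f) ?E"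
    using IJ by (subst distr_PiM_curry[OF N]) (auto simp: inj_on_def)
  also have "\<dots> = emeasure ?L (?f -` ?E \<inter> space ?L)" by (rule emeasure_distr[OF f E])
  also have "\<dots> = emeasure (distr ?L (PiM J (\<lambda>_. PiM I (\<lambda>_. N))) ?h) (PiE J (\<lambda>_. A))"
    unfolding vimage by (rule emeasure_distr[OF h B, symmetric])
  also have "distr ?L (PiM J (\<lambda>_. PiM I (\<lambda>_. N))) ?h = PiM J (\<lambda>_. PiM I (\<lambda>_. N))"
    using IJ by (intro distr_PiM_curry[OF N]) (auto simp: inj_on_def)
  also have "emeasure \<dots> (PiE J (\<lambda>_. A)) = emeasure (PiM I (\<lambda>_. N)) A ^ card J"
    using IJ by (subst emeasure_PiM) auto
  finally show ?thesis .
qed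

lemma torus_dist_le_iff: "D \<ge> 1 \<Longrightarrow> torus_dist D x y \<le> r \<longleftrightarrow> (\<forall>d\<in>{1..D}. dist (x d) (y d) \<le> r)"
  by (subst torus_dist_def, subst Max_le_iff) auto

text \<open>The general relation \<open>R\<close> covers both events needed later: the cliques of a
  packing, and these together with one additional edge.\<close>

lemma emeasure_close_circle:
  assumes I: "finite I" and R: "R \<subseteq> I \<times> I"
  shows "{y \<in> space (PiM I (\<lambda>_. circle_uniform)). \<forall>(i, j)\<in>R. dist (y i) (y j) \<le> r}
      \<in> sets (PiM I (\<lambda>_. circle_uniform))" (is "?A \<in> _")
    and "emeasure (PiM I (\<lambda>_. circle_uniform))
        {y \<in> space (PiM I (\<lambda>_. circle_uniform)). \<forall>(i, j)\<in>R. dist (y i) (y j) \<le> r}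
      = emeasure (PiM I (\<lambda>_. unit_uniform))
        {x \<in> space (PiM I (\<lambda>_. unit_uniform)). \<forall>(i, j)\<in>R. torus_norm (x i - x j) \<le> r}"
proof -
  have finR: "finite R" using finite_subset[OF R] I by auto
  show A: "?A \<in> sets (PiM I (\<lambda>_. circle_uniform))"
  proof -
    have [measurable]: "(\<lambda>y. dist (y (fst p)) (y (snd p))) \<in> borel_measurable (PiM I (\<lambda>_. circle_uniform))"
      if "p \<in> R" for p
      using that R by (intro borel_measurable_dist measurable_PiM_component_rev) auto
    show ?thesis unfolding case_prod_unfold using finR by measurable
  qed
  have eq: "PiM I (\<lambda>_. circle_uniform) = distr (PiM I (\<lambda>_. unit_uniform)) (PiM I (\<lambda>_. circle_uniform)) (compose I to_circle)"
  proof -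
    have "PiM I (\<lambda>_. circle_uniform) = PiM I (\<lambda>_. distr unit_uniform circle_uniform to_circle)"
    proof -
      have "distr unit_uniform circle_uniform to_circle = distr unit_uniform borel to_circle"
        by (intro distr_cong) auto
      then show ?thesis by (simp add: circle_uniform_eq)
    qed
    also have "\<dots> = distr (PiM I (\<lambda>_. unit_uniform)) (PiM I (\<lambda>_. circle_uniform)) (compose I to_circle)"
      using I by (intro distr_PiM_finite_prob_space'[symmetric])
        (auto intro: prob_space_unit_uniform prob_space_circle_uniform)
    finally show ?thesis .
  qed
  have meas: "compose I to_circle \<in> measurable (PiM I (\<lambda>_. unit_uniform)) (PiM I (\<lambda>_. circle_uniform))"
    unfolding compose_def
    by (intro measurable_restrict measurable_compose[OF measurable_component_singleton]) auto
  have "emeasure (PiM I (\<lambda>_. circle_uniform)) ?A =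
      emeasure (PiM I (\<lambda>_. unit_uniform)) (compose I to_circle -` ?A \<inter> space (PiM I (\<lambda>_. unit_uniform)))"
    by (subst eq) (rule emeasure_distr[OF meas A])
  also have "compose I to_circle -` ?A \<inter> space (PiM I (\<lambda>_. unit_uniform)) =
      {x \<in> space (PiM I (\<lambda>_. unit_uniform)). \<forall>(i, j)\<in>R. torus_norm (x i - x j) \<le> r}"
  proof -
    have "(\<forall>(i, j)\<in>R. dist (compose I to_circle x i) (compose I to_circle x j) \<le> r) \<longleftrightarrow>
        (\<forall>(i, j)\<in>R. torus_norm (x i - x j) \<le> r)" for x
      using R by (intro ball_cong refl) (auto simp: compose_def dist_to_circle)
    then show ?thesis using measurable_space[OF meas] by auto
  qed
  finally show "emeasure (PiM I (\<lambda>_. circle_uniform)) ?A = emeasure (PiM I (\<lambda>_. unit_uniform))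
        {x \<in> space (PiM I (\<lambda>_. unit_uniform)). \<forall>(i, j)\<in>R. torus_norm (x i - x j) \<le> r}" .
qed

context prob_space
begin

text \<open>For the maximum metric, closeness of two points is closeness in every coordinate. The
  coordinates are independent copies of the circle model, hence the power \<open>D\<close>.\<close>

lemma emeasure_close_pairs:
  assumes D: "D \<ge> 1" and I: "finite I" "I \<noteq> {}"
    and ind: "indep_vars (\<lambda>_. torus_uniform D) X I"
    and law: "\<And>i. i \<in> I \<Longrightarrow> distr M (torus_uniform D) (X i) = torus_uniform D"
    and R: "R \<subseteq> I \<times> I"
  shows "{\<omega> \<in> space M. \<forall>(i, j)\<in>R. torus_dist D (X i \<omega>) (X j \<omega>) \<le> r} \<in> events"
    and "emeasure M {\<omega> \<in> space M. \<forall>(i, j)\<in>R. torus_dist D (X i \<omega>) (X j \<omega>) \<le> r}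
      = emeasure (PiM I (\<lambda>_. unit_uniform))
        {x \<in> space (PiM I (\<lambda>_. unit_uniform)). \<forall>(i, j)\<in>R. torus_norm (x i - x j) \<le> r} ^ D"
proof -
  let ?T = "PiM I (\<lambda>_. torus_uniform D)"
  define A where "A = {y \<in> space (PiM I (\<lambda>_. circle_uniform)). \<forall>(i, j)\<in>R. dist (y i) (y j) \<le> r}"
  have A: "A \<in> sets (PiM I (\<lambda>_. circle_uniform))"
    unfolding A_def by (rule emeasure_close_circle(1)[OF I(1) R])
  let ?Z = "\<lambda>\<omega>. \<lambda>i\<in>I. X i \<omega>"
  let ?E = "{x \<in> space ?T. \<forall>d\<in>{1..D}. (\<lambda>i\<in>I. x i d) \<in> A}"
  have X: "X i \<in> measurable M (torus_uniform D)" if "i \<in> I" for i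
    using ind that by (auto simp: indep_vars_def)
  then have Z: "?Z \<in> measurable M ?T" by (intro measurable_restrict)
  have E: "?E \<in> sets ?T"
  proof -
    have [measurable]: "(\<lambda>x. \<lambda>i\<in>I. x i d) \<in> measurable ?T (PiM I (\<lambda>_. circle_uniform))"
      if "d \<in> {1..D}" for d
      unfolding torus_uniform_def
      using that by (intro measurable_restrict measurable_PiM_component_rev[where f = "\<lambda>y. y d"] measurable_component_singleton)
    show ?thesis using A I by measurable
  qed
  have distr: "distr M ?T ?Z = ?T"
  proof -
    have "distr M ?T ?Z = PiM I (\<lambda>i. distr M (torus_uniform D) (X i))"
      using ind I X by (subst (asm) indep_vars_iff_distr_eq_PiM') auto
    then show ?thesis using law by (simp cong: PiM_cong)
  qed
  have vimage: "{\<omega> \<in> space M. \<forall>(i, j)\<in>R. torus_dist D (X i \<omega>) (X j \<omega>) \<le> r} = ?Z -` ?E \<inter> space M"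
  proof (intro set_eqI)
    fix \<omega>
    have "(\<forall>(i, j)\<in>R. torus_dist D (X i \<omega>) (X j \<omega>) \<le> r) \<longleftrightarrow>
        (\<forall>d\<in>{1..D}. \<forall>(i, j)\<in>R. dist (X i \<omega> d) (X j \<omega> d) \<le> r)"
      using D by (auto simp: torus_dist_le_iff)
    moreover have "(\<lambda>i\<in>I. ?Z \<omega> i d) \<in> A \<longleftrightarrow> (\<forall>(i, j)\<in>R. dist (X i \<omega> d) (X j \<omega> d) \<le> r)" for d
    proof -
      have "(\<lambda>i\<in>I. ?Z \<omega> i d) \<in> space (PiM I (\<lambda>_. circle_uniform))"
        by (auto simp: space_PiM)
      moreover have "(\<forall>(i, j)\<in>R. dist ((\<lambda>i\<in>I. ?Z \<omega> i d) i) ((\<lambda>i\<in>I. ?Z \<omega> i d) j) \<le> r) \<longleftrightarrow>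
          (\<forall>(i, j)\<in>R. dist (X i \<omega> d) (X j \<omega> d) \<le> r)"
        using R by (intro ball_cong refl) auto
      ultimately show ?thesis by (simp add: A_def)
    qed
    ultimately show "\<omega> \<in> {\<omega> \<in> space M. \<forall>(i, j)\<in>R. torus_dist D (X i \<omega>) (X j \<omega>) \<le> r} \<longleftrightarrow> \<omega> \<in> ?Z -` ?E \<inter> space M"
      using measurable_space[OF Z, of \<omega>] by auto
  qed
  show "{\<omega> \<in> space M. \<forall>(i, j)\<in>R. torus_dist D (X i \<omega>) (X j \<omega>) \<le> r} \<in> events"
    unfolding vimage using Z E by (rule measurable_sets)
  have "emeasure M {\<omega> \<in> space M. \<forall>(i, j)\<in>R. torus_dist D (X i \<omega>) (X j \<omega>) \<le> r} = emeasure (distr M ?T ?Z) ?E"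
    unfolding vimage by (rule emeasure_distr[OF Z E, symmetric])
  also have "\<dots> = emeasure (PiM I (\<lambda>_. circle_uniform)) A ^ card {1..D}"
    unfolding distr unfolding torus_uniform_def
    using D I A by (intro emeasure_PiM_PiM_coordinatewise prob_space_circle_uniform) auto
  also have "emeasure (PiM I (\<lambda>_. circle_uniform)) A = emeasure (PiM I (\<lambda>_. unit_uniform))
        {x \<in> space (PiM I (\<lambda>_. unit_uniform)). \<forall>(i, j)\<in>R. torus_norm (x i - x j) \<le> r}"
    unfolding A_def by (rule emeasure_close_circle(2)[OF I(1) R])
  finally show "emeasure M {\<omega> \<in> space M. \<forall>(i, j)\<in>R. torus_dist D (X i \<omega>) (X j \<omega>) \<le> r}
      = emeasure (PiM I (\<lambda>_. unit_uniform))
        {x \<in> space (PiM I (\<lambda>_. unit_uniform)). \<forall>(i, j)\<in>R. torus_norm (x i - x j) \<le> r} ^ D" by simp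
qed

end

section \<open>Binomial moments of the number of isolated cliques\<close>

text \<open>By equal cardinality \<open>T\<close> has a vertex outside \<open>S\<close>. It is
  adjacent to any common vertex within the clique \<open>T\<close>, against the isolation of
  \<open>S\<close>.\<close>

lemma isolated_cliques_disjoint:
  assumes V: "finite V" and S: "S \<in> isolated_cliques k V E" and T: "T \<in> isolated_cliques k V E"
    and ne: "S \<noteq> T"
  shows "S \<inter> T = {}"
proof (rule ccontr)
  assume "S \<inter> T \<noteq> {}"
  then obtain w where w: "w \<in> S" "w \<in> T" by blast
  have "finite S" "card S = card T"
    using V S T by (auto simp: isolated_cliques_def intro: finite_subset)
  with ne have "\<not> T \<subseteq> S" using card_subset_eq[of S T] by auto
  then obtain v where v: "v \<in> T" "v \<notin> S" by blast
  then have "v \<in> V - S" using T by (auto simp: isolated_cliques_def)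
  then have "\<not> E w v" using S w by (auto simp: isolated_cliques_def)
  moreover have "w \<noteq> v" using v w by blast
  then have "E w v" using T w v by (auto simp: isolated_cliques_def)
  ultimately show False by blast
qed

text \<open>Isolated cliques are pairwise disjoint, so every \<open>m\<close>-element set of them is
  a packing. The binomial moment thus becomes a sum over a deterministic set of packings.\<close>

lemma card_isolated_cliques_choose:
  assumes V: "finite V"
  shows "card (isolated_cliques k V E) choose m = card {F \<in> packings k m V. F \<subseteq> isolated_cliques k V E}"
proof -
  let ?I = "isolated_cliques k V E"
  have fin: "finite ?I"
    using V by (intro finite_subset[of ?I "Pow V"]) (auto simp: isolated_cliques_def)
  have "{F \<in> packings k m V. F \<subseteq> ?I} = {F. F \<subseteq> ?I \<and> card F = m}"
  proof (intro equalityI subsetI)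
    fix F assume F: "F \<in> {F. F \<subseteq> ?I \<and> card F = m}"
    then have "disjoint F"
      using isolated_cliques_disjoint[OF V] unfolding disjoint_def by blast
    moreover have "finite F" using F fin by (auto intro: finite_subset)
    ultimately show "F \<in> {F \<in> packings k m V. F \<subseteq> ?I}"
      using F by (auto simp: packings_def isolated_cliques_def)
  qed (auto simp: packings_def)
  then show ?thesis using n_subsets[OF fin, of m] by simp
qed

context prob_space
begin

lemma bonferroni_expectation:
  fixes W :: "'a \<Rightarrow> nat"
  assumes W [measurable]: "W \<in> measurable M (count_space UNIV)"
    and int: "\<And>m. integrable M (\<lambda>\<omega>. real (W \<omega> choose m))"
  shows "\<bar>prob {\<omega> \<in> space M. W \<omega> = j} -
      (\<Sum>i\<le>N. (-1) ^ i * real (j + i choose j) * expectation (\<lambda>\<omega>. real (W \<omega> choose (j + i))))\<bar>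
    \<le> real (j + Suc N choose j) * expectation (\<lambda>\<omega>. real (W \<omega> choose (j + Suc N)))"
proof -
  define A where "A = {\<omega> \<in> space M. W \<omega> = j}"
  define g where "g \<omega> = (\<Sum>i\<le>N. (-1) ^ i * real (j + i choose j) * real (W \<omega> choose (j + i)))" for \<omega>
  define h where "h \<omega> = real (j + Suc N choose j) * real (W \<omega> choose (j + Suc N))" for \<omega>
  have A: "A \<in> events" unfolding A_def by measurable
  have indA: "integrable M (indicator A :: 'a \<Rightarrow> real)"
    using A by (intro integrable_real_indicator) (auto simp: emeasure_eq_measure)
  have intg: "integrable M g"
    unfolding g_def by (intro Bochner_Integration.integrable_sum integrable_mult_right int)
  have inth: "integrable M h" unfolding h_def by (intro integrable_mult_right int)
  have Eg: "expectation g =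
      (\<Sum>i\<le>N. (-1) ^ i * real (j + i choose j) * expectation (\<lambda>\<omega>. real (W \<omega> choose (j + i))))"
    unfolding g_def
    by (subst Bochner_Integration.integral_sum)
      (intro integrable_mult_right int, simp only: Bochner_Integration.integral_mult_right_zero)
  have Eh: "expectation h = real (j + Suc N choose j) * expectation (\<lambda>\<omega>. real (W \<omega> choose (j + Suc N)))"
    unfolding h_def by (rule Bochner_Integration.integral_mult_right_zero)
  have "prob A - expectation g = expectation (\<lambda>\<omega>. indicator A \<omega> - g \<omega>)"
    using A by (simp add: Bochner_Integration.integral_diff[OF indA intg])
  also have "\<bar>\<dots>\<bar> \<le> expectation (\<lambda>\<omega>. \<bar>indicator A \<omega> - g \<omega>\<bar>)" by (rule integral_abs_bound)
  also have "\<dots> \<le> expectation h"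
  proof (rule integral_mono)
    show "integrable M (\<lambda>\<omega>. \<bar>indicator A \<omega> - g \<omega>\<bar>)"
      by (intro integrable_abs Bochner_Integration.integrable_diff indA intg)
    show "integrable M h" by (rule inth)
    fix \<omega> assume "\<omega> \<in> space M"
    then have "indicator A \<omega> = (if W \<omega> = j then 1 else 0 :: real)" by (simp add: A_def)
    then show "\<bar>indicator A \<omega> - g \<omega>\<bar> \<le> h \<omega>"
      unfolding g_def h_def using bonferroni[of "W \<omega>" j N] by (simp only:)
  qed
  finally show ?thesis unfolding Eg Eh A_def .
qed

lemma expectation_choose:
  fixes W :: "'a \<Rightarrow> nat"
  assumes fin: "finite P" and ev: "\<And>F. F \<in> P \<Longrightarrow> {\<omega> \<in> space M. Q F \<omega>} \<in> events"
    and W: "\<And>\<omega>. \<omega> \<in> space M \<Longrightarrow> W \<omega> choose m = card {F \<in> P. Q F \<omega>}"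
  shows "integrable M (\<lambda>\<omega>. real (W \<omega> choose m))"
    and "expectation (\<lambda>\<omega>. real (W \<omega> choose m)) = (\<Sum>F\<in>P. prob {\<omega> \<in> space M. Q F \<omega>})"
proof -
  have eq: "real (W \<omega> choose m) = (\<Sum>F\<in>P. indicator {\<omega> \<in> space M. Q F \<omega>} \<omega>)" if "\<omega> \<in> space M" for \<omega>
  proof -
    have "real (card {F \<in> P. Q F \<omega>}) = (\<Sum>F\<in>P. if Q F \<omega> then 1 else 0)"
      using fin by (simp add: sum.If_cases Int_def)
    then show ?thesis using that W[OF that] by (simp add: indicator_def of_bool_def)
  qed
  have int: "integrable M (indicator {\<omega> \<in> space M. Q F \<omega>} :: 'a \<Rightarrow> real)" if "F \<in> P" for F
    using ev[OF that] by (intro integrable_real_indicator) (auto simp: emeasure_eq_measure)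
  have "integrable M (\<lambda>\<omega>. \<Sum>F\<in>P. indicator {\<omega> \<in> space M. Q F \<omega>} \<omega> :: real)"
    by (intro Bochner_Integration.integrable_sum int)
  then show "integrable M (\<lambda>\<omega>. real (W \<omega> choose m))"
    by (subst Bochner_Integration.integrable_cong[OF refl eq])
  have "expectation (\<lambda>\<omega>. real (W \<omega> choose m)) = expectation (\<lambda>\<omega>. \<Sum>F\<in>P. indicator {\<omega> \<in> space M. Q F \<omega>} \<omega>)"
    by (rule Bochner_Integration.integral_cong[OF refl eq])
  also have "\<dots> = (\<Sum>F\<in>P. expectation (indicator {\<omega> \<in> space M. Q F \<omega>}))"
    by (rule Bochner_Integration.integral_sum) (rule int)
  also have "\<dots> = (\<Sum>F\<in>P. prob {\<omega> \<in> space M. Q F \<omega>})"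
    using ev by (intro sum.cong refl) simp
  finally show "expectation (\<lambda>\<omega>. real (W \<omega> choose m)) = (\<Sum>F\<in>P. prob {\<omega> \<in> space M. Q F \<omega>})" .
qed

end

locale torus_sample = prob_space +
  fixes D :: nat and I :: "nat set" and X :: "nat \<Rightarrow> 'a \<Rightarrow> nat \<Rightarrow> circle"
  assumes D: "D \<ge> 1" and I: "finite I"
    and ind: "indep_vars (\<lambda>_. torus_uniform D) X I"
    and law: "\<And>i. i \<in> I \<Longrightarrow> distr M (torus_uniform D) (X i) = torus_uniform D"
begin

lemma close_pairs:
  assumes "I \<noteq> {}" "R \<subseteq> I \<times> I"
  shows "{\<omega> \<in> space M. \<forall>(i, j)\<in>R. torus_dist D (X i \<omega>) (X j \<omega>) \<le> r} \<in> events"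
    and "emeasure M {\<omega> \<in> space M. \<forall>(i, j)\<in>R. torus_dist D (X i \<omega>) (X j \<omega>) \<le> r}
      = emeasure (PiM I (\<lambda>_. unit_uniform))
        {x \<in> space (PiM I (\<lambda>_. unit_uniform)). \<forall>(i, j)\<in>R. torus_norm (x i - x j) \<le> r} ^ D"
proof -
  show "{\<omega> \<in> space M. \<forall>(i, j)\<in>R. torus_dist D (X i \<omega>) (X j \<omega>) \<le> r} \<in> events"
    by (rule emeasure_close_pairs(1)[OF D I assms(1) ind _ assms(2)]) (rule law)
  show "emeasure M {\<omega> \<in> space M. \<forall>(i, j)\<in>R. torus_dist D (X i \<omega>) (X j \<omega>) \<le> r}
      = emeasure (PiM I (\<lambda>_. unit_uniform))
        {x \<in> space (PiM I (\<lambda>_. unit_uniform)). \<forall>(i, j)\<in>R. torus_norm (x i - x j) \<le> r} ^ D"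
    by (rule emeasure_close_pairs(2)[OF D I assms(1) ind _ assms(2)]) (rule law)
qed

lemma close_event:
  assumes "u \<in> I" "v \<in> I"
  shows "{\<omega> \<in> space M. torus_dist D (X u \<omega>) (X v \<omega>) \<le> r} \<in> events"
proof -
  have "I \<noteq> {}" "{(u, v)} \<subseteq> I \<times> I" using assms by auto
  from close_pairs(1)[OF this] show ?thesis by simp
qed

lemma isolated_clique_event:
  "{\<omega> \<in> space M. S \<in> isolated_cliques k I (\<lambda>u v. torus_dist D (X u \<omega>) (X v \<omega>) \<le> r)} \<in> events"
proof (cases "S \<subseteq> I \<and> card S = k")
  case True
  have S: "S \<subseteq> I" "countable S" "countable (I - S)"
    using True I by (auto intro: finite_subset countable_finite)
  have "{\<omega> \<in> space M. u \<noteq> v \<longrightarrow> torus_dist D (X u \<omega>) (X v \<omega>) \<le> r} \<in> events"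
    if "u \<in> S" "v \<in> S" for u v
    using close_event[of u v] that S(1) by (cases "u = v") auto
  then have A: "{\<omega> \<in> space M. \<forall>v\<in>S. u \<noteq> v \<longrightarrow> torus_dist D (X u \<omega>) (X v \<omega>) \<le> r} \<in> events"
    if "u \<in> S" for u
    using S(2) that by (intro sets.sets_Collect_countable_All')
  have C1: "{\<omega> \<in> space M. \<forall>u\<in>S. \<forall>v\<in>S. u \<noteq> v \<longrightarrow> torus_dist D (X u \<omega>) (X v \<omega>) \<le> r} \<in> events"
    by (rule sets.sets_Collect_countable_All'[OF _ S(2)], rule A)
  have "{\<omega> \<in> space M. \<not> torus_dist D (X u \<omega>) (X v \<omega>) \<le> r} \<in> events"
    if "u \<in> S" "v \<in> I - S" for u v
    using that S(1) by (intro sets.sets_Collect_neg close_event) auto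
  then have B: "{\<omega> \<in> space M. \<forall>v\<in>I - S. \<not> torus_dist D (X u \<omega>) (X v \<omega>) \<le> r} \<in> events"
    if "u \<in> S" for u
    using S(3) that by (intro sets.sets_Collect_countable_All')
  have C2: "{\<omega> \<in> space M. \<forall>u\<in>S. \<forall>v\<in>I - S. \<not> torus_dist D (X u \<omega>) (X v \<omega>) \<le> r} \<in> events"
    by (rule sets.sets_Collect_countable_All'[OF _ S(2)], rule B)
  from C1 C2 have "{\<omega> \<in> space M. (\<forall>u\<in>S. \<forall>v\<in>S. u \<noteq> v \<longrightarrow> torus_dist D (X u \<omega>) (X v \<omega>) \<le> r) \<and>
      (\<forall>u\<in>S. \<forall>v\<in>I - S. \<not> torus_dist D (X u \<omega>) (X v \<omega>) \<le> r)} \<in> events"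
    by (intro sets.sets_Collect_conj)
  moreover have "S \<in> isolated_cliques k I E \<longleftrightarrow>
      (\<forall>u\<in>S. \<forall>v\<in>S. u \<noteq> v \<longrightarrow> E u v) \<and> (\<forall>u\<in>S. \<forall>v\<in>I - S. \<not> E u v)" for E
    using True unfolding isolated_cliques_def mem_Collect_eq by blast
  ultimately show ?thesis by (simp only:)
next
  case False
  then have "S \<notin> isolated_cliques k I E" for E
    unfolding isolated_cliques_def mem_Collect_eq by blast
  then show ?thesis by simp
qed

lemma isolated_packing_event:
  assumes "finite F"
  shows "{\<omega> \<in> space M. F \<subseteq> isolated_cliques k I (\<lambda>u v. torus_dist D (X u \<omega>) (X v \<omega>) \<le> r)} \<in> events"
  unfolding subset_eq using assms
  by (intro sets.sets_Collect_countable_All'[OF isolated_clique_event] countable_finite)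

lemma measurable_card_isolated_cliques:
  "(\<lambda>\<omega>. card (isolated_cliques k I (\<lambda>u v. torus_dist D (X u \<omega>) (X v \<omega>) \<le> r))) \<in> measurable M (count_space UNIV)"
proof -
  let ?S = "\<lambda>\<omega>. isolated_cliques k I (\<lambda>u v. torus_dist D (X u \<omega>) (X v \<omega>) \<le> r)"
  have fin: "finite S" if "S \<in> ?S \<omega>" for S \<omega>
    using that I unfolding isolated_cliques_def by (blast intro: finite_subset)
  \<comment> \<open>\<open>measurable_card\<close> is available for sets of natural numbers only.\<close>
  have "inj_on set_encode (?S \<omega>)" for \<omega>
    by (rule inj_on_subset[OF inj_on_set_encode]) (blast intro: fin)
  then have "card (?S \<omega>) = card (set_encode ` ?S \<omega>)" for \<omega> by (rule card_image[symmetric])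
  moreover have "(\<lambda>\<omega>. card (set_encode ` ?S \<omega>)) \<in> measurable M (count_space UNIV)"
  proof (rule measurable_card)
    fix i
    have "i \<in> set_encode ` ?S \<omega> \<longleftrightarrow> set_decode i \<in> ?S \<omega>" for \<omega>
    proof
      assume "i \<in> set_encode ` ?S \<omega>"
      then obtain S where "i = set_encode S" "S \<in> ?S \<omega>" by blast
      then show "set_decode i \<in> ?S \<omega>" using fin[of S \<omega>] by (simp add: set_encode_inverse)
    next
      assume "set_decode i \<in> ?S \<omega>"
      then show "i \<in> set_encode ` ?S \<omega>" by (rule image_eqI[rotated]) (simp add: set_decode_inverse)
    qed
    then show "{\<omega> \<in> space M. i \<in> set_encode ` ?S \<omega>} \<in> events"
      by (simp only: isolated_clique_event)
  qed
  ultimately show ?thesis by (simp only:)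
qed

text \<open>The probability of \<open>K\<close>, where all members are cliques, is known exactly.
  Isolation can fail only through an edge from a vertex of some member to a vertex outside that
  member. A union bound over these at most \<open>m * k * card I\<close> edges gives the lower
  estimate.\<close>

lemma prob_isolated_packing:
  assumes F: "F \<in> packings k m I" and k: "k \<ge> 1" and r: "0 \<le> r" "r < 1/3"
  shows "prob {\<omega> \<in> space M. F \<subseteq> isolated_cliques k I (\<lambda>u v. torus_dist D (X u \<omega>) (X v \<omega>) \<le> r)}
      \<le> (real k * r ^ (k - 1)) ^ (m * D)" (is "prob ?E \<le> _")
    and "(real k * r ^ (k - 1)) ^ (m * D) - real (m * k * card I) * (4 * r) ^ ((m * (k - 1) + 1) * D)
      \<le> prob {\<omega> \<in> space M. F \<subseteq> isolated_cliques k I (\<lambda>u v. torus_dist D (X u \<omega>) (X v \<omega>) \<le> r)}"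
proof -
  have finF: "finite F" and cardF: "card F = m" and FS: "\<And>S. S \<in> F \<Longrightarrow> S \<subseteq> I \<and> card S = k"
    using F by (auto simp: packings_def)
  define R where "R = (\<Union>S\<in>F. S \<times> S)"
  define T where "T = (SIGMA S:F. S \<times> (I - S))"
  define K where "K = {\<omega> \<in> space M. \<forall>(i, j)\<in>R. torus_dist D (X i \<omega>) (X j \<omega>) \<le> r}"
  define B where "B = (\<lambda>(S :: nat set, u, v). {\<omega> \<in> space M. \<forall>(i, j)\<in>insert (u, v) R. torus_dist D (X i \<omega>) (X j \<omega>) \<le> r})"
  have RI: "R \<subseteq> I \<times> I" using FS by (auto simp: R_def)
  have E: "?E \<in> events" using finF by (rule isolated_packing_event)
  have K: "K \<in> events \<and> prob K = (real k * r ^ (k - 1)) ^ (m * D)"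
  proof (cases "I = {}")
    case True
    have "S \<notin> F" for S
    proof
      assume "S \<in> F"
      from FS[OF this] True k show False by auto
    qed
    then have "F = {}" by blast
    then show ?thesis using cardF by (auto simp: K_def R_def prob_space)
  next
    case False
    have "emeasure M K = ennreal ((real k * r ^ (k - 1)) ^ m) ^ D"
      unfolding K_def close_pairs(2)[OF False RI]
      using emeasure_cliques[OF I F k r] by (simp add: R_def ball_Un)
    also have "\<dots> = ennreal ((real k * r ^ (k - 1)) ^ (m * D))"
      using r by (simp add: ennreal_power power_mult)
    finally show ?thesis
      using close_pairs(1)[OF False RI] r by (simp add: K_def measure_def)
  qed
  have B: "B t \<in> events \<and> prob (B t) \<le> (4 * r) ^ ((m * (k - 1) + 1) * D)" if t: "t \<in> T" for t
  proof -
    obtain S u v where t': "t = (S, u, v)" "S \<in> F" "u \<in> S" "v \<in> I - S" using t by (auto simp: T_def)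
    then have R': "insert (u, v) R \<subseteq> I \<times> I" and ne: "I \<noteq> {}" using RI FS by auto
    have "emeasure M (B t) \<le> ennreal ((4 * r) ^ (m * (k - 1) + 1)) ^ D"
      unfolding B_def t'(1) prod.case close_pairs(2)[OF ne R']
      using emeasure_cliques_edge[OF I F k r(1) t'(2-4)]
      by (intro power_mono) (auto simp: R_def conj_commute)
    also have "\<dots> = ennreal ((4 * r) ^ ((m * (k - 1) + 1) * D))"
      unfolding power_mult using r by (intro ennreal_power) simp
    finally show ?thesis
      using close_pairs(1)[OF ne R'] r by (simp add: B_def t'(1) emeasure_eq_measure)
  qed
  \<comment> \<open>The relation \<open>R\<close> contains diagonal pairs, about which
    \<open>isolated_cliques\<close> says nothing.\<close>
  have refl: "torus_dist D x x \<le> r" for x using D r by (simp add: torus_dist_le_iff)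
  have EK: "?E \<subseteq> K"
  proof
    fix \<omega> assume \<omega>: "\<omega> \<in> ?E"
    have "torus_dist D (X i \<omega>) (X j \<omega>) \<le> r" if "S \<in> F" "i \<in> S" "j \<in> S" for S i j
    proof (cases "i = j")
      case True
      then show ?thesis by (simp add: refl)
    next
      case False
      have "S \<in> isolated_cliques k I (\<lambda>u v. torus_dist D (X u \<omega>) (X v \<omega>) \<le> r)"
        using \<omega> that(1) by blast
      with False that(2,3) show ?thesis unfolding isolated_cliques_def by blast
    qed
    with \<omega> show "\<omega> \<in> K" by (auto simp: K_def R_def)
  qed
  then show "prob ?E \<le> (real k * r ^ (k - 1)) ^ (m * D)"
    using finite_measure_mono[OF EK] K by simp
  have sub: "K \<subseteq> ?E \<union> (\<Union>t\<in>T. B t)"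
  proof
    fix \<omega> assume \<omega>: "\<omega> \<in> K"
    show "\<omega> \<in> ?E \<union> (\<Union>t\<in>T. B t)"
    proof (cases "\<exists>S\<in>F. \<exists>u\<in>S. \<exists>v\<in>I - S. torus_dist D (X u \<omega>) (X v \<omega>) \<le> r")
      case True
      then obtain S u v where "S \<in> F" "u \<in> S" "v \<in> I - S" "torus_dist D (X u \<omega>) (X v \<omega>) \<le> r" by blast
      then have "(S, u, v) \<in> T" "\<omega> \<in> B (S, u, v)" using \<omega> by (auto simp: T_def B_def K_def)
      then show ?thesis by blast
    next
      case False
      have "S \<in> isolated_cliques k I (\<lambda>u v. torus_dist D (X u \<omega>) (X v \<omega>) \<le> r)" if "S \<in> F" for S
      proof -
        have "torus_dist D (X i \<omega>) (X j \<omega>) \<le> r" if "i \<in> S" "j \<in> S" for i j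
          using \<omega> \<open>S \<in> F\<close> that unfolding K_def R_def by blast
        with that FS[OF that] False show ?thesis unfolding isolated_cliques_def by blast
      qed
      moreover have "\<omega> \<in> space M" using \<omega> unfolding K_def by blast
      ultimately show ?thesis by blast
    qed
  qed
  have finT: "finite T" and cardT: "card T \<le> m * k * card I"
  proof -
    have fS: "finite S" if "S \<in> F" for S using FS[OF that] I by (auto intro: finite_subset)
    then show "finite T" unfolding T_def using finF I by (intro finite_SigmaI finite_cartesian_product) auto
    have "card T = (\<Sum>S\<in>F. card S * card (I - S))"
      unfolding T_def using finF I fS by (subst card_SigmaI) (auto simp: card_cartesian_product)
    also have "\<dots> \<le> (\<Sum>S\<in>F. k * card I)"
      using FS I by (intro sum_mono mult_mono) (auto intro: card_mono)
    finally show "card T \<le> m * k * card I" by (simp add: cardF)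
  qed
  have BU: "(\<Union>t\<in>T. B t) \<in> events" using finT B by (intro sets.finite_UN) blast+
  have "prob K \<le> prob (?E \<union> (\<Union>t\<in>T. B t))"
    using sub by (rule finite_measure_mono) (rule sets.Un[OF E BU])
  also have "\<dots> \<le> prob ?E + prob (\<Union>t\<in>T. B t)"
    by (rule measure_Un_le[OF E BU])
  also have "prob (\<Union>t\<in>T. B t) \<le> (\<Sum>t\<in>T. prob (B t))"
    using B finT by (intro finite_measure_subadditive_finite) auto
  also have "\<dots> \<le> (\<Sum>t\<in>T. (4 * r) ^ ((m * (k - 1) + 1) * D))" using B by (intro sum_mono) auto
  also have "\<dots> \<le> real (m * k * card I) * (4 * r) ^ ((m * (k - 1) + 1) * D)"
    using cardT r by (simp only: sum_constant) (intro mult_right_mono of_nat_mono zero_le_power, auto)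
  finally show "(real k * r ^ (k - 1)) ^ (m * D) - real (m * k * card I) * (4 * r) ^ ((m * (k - 1) + 1) * D)
      \<le> prob ?E" using K by simp
qed

end

section \<open>A first-order sentence for complete components\<close>

text \<open>The empty conjunction \<open>Eq 0 0\<close> makes variable \<open>0\<close> free; below it is always bound.\<close>

definition fo_conj :: "fo_formula list \<Rightarrow> fo_formula" where
  "fo_conj \<phi>s = foldr Conj \<phi>s (Eq 0 0)"

lemma fo_sat_fo_conj [simp]: "fo_sat G e (fo_conj \<phi>s) \<longleftrightarrow> (\<forall>\<phi>\<in>set \<phi>s. fo_sat G e \<phi>)"
  unfolding fo_conj_def by (induction \<phi>s) auto

lemma free_vars_fo_conj [simp]: "free_vars (fo_conj \<phi>s) = {0} \<union> (\<Union>\<phi>\<in>set \<phi>s. free_vars \<phi>)"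
  unfolding fo_conj_def by (induction \<phi>s) auto

text \<open>A block of quantifiers is one simultaneous choice \<open>f\<close> of witnesses, which
  is the form in which a clique is enumerated below.\<close>

lemma fo_sat_foldr_Exists:
  "fo_sat G e (foldr Exists xs \<phi>) \<longleftrightarrow>
    (\<exists>f. (\<forall>x\<in>set xs. f x \<in> pverts G) \<and> fo_sat G (\<lambda>x. if x \<in> set xs then f x else e x) \<phi>)"
proof (induction xs arbitrary: e)
  case (Cons y xs)
  show ?case
  proof
    assume "fo_sat G e (foldr Exists (y # xs) \<phi>)"
    then obtain v f where v: "v \<in> pverts G" and f: "\<forall>x\<in>set xs. f x \<in> pverts G"
      and sat: "fo_sat G (\<lambda>x. if x \<in> set xs then f x else (e(y := v)) x) \<phi>"
      by (auto simp: Cons.IH)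
    \<comment> \<open>If \<open>y\<close> is quantified again in \<open>xs\<close>, the inner
      witness shadows \<open>v\<close>.\<close>
    define f' where "f' x = (if x \<in> set xs then f x else v)" for x
    have "(\<lambda>x. if x \<in> set (y # xs) then f' x else e x) = (\<lambda>x. if x \<in> set xs then f x else (e(y := v)) x)"
      by (auto simp: f'_def fun_eq_iff)
    with sat have "fo_sat G (\<lambda>x. if x \<in> set (y # xs) then f' x else e x) \<phi>" by (simp only:)
    moreover have "\<forall>x\<in>set (y # xs). f' x \<in> pverts G" using v f by (simp add: f'_def)
    ultimately show "\<exists>f. (\<forall>x\<in>set (y # xs). f x \<in> pverts G) \<and>
        fo_sat G (\<lambda>x. if x \<in> set (y # xs) then f x else e x) \<phi>" by blast
  next
    assume "\<exists>f. (\<forall>x\<in>set (y # xs). f x \<in> pverts G) \<and>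
        fo_sat G (\<lambda>x. if x \<in> set (y # xs) then f x else e x) \<phi>"
    then obtain f where f: "\<forall>x\<in>set (y # xs). f x \<in> pverts G"
      and sat: "fo_sat G (\<lambda>x. if x \<in> set (y # xs) then f x else e x) \<phi>" by blast
    have "(\<lambda>x. if x \<in> set (y # xs) then f x else e x) = (\<lambda>x. if x \<in> set xs then f x else (e(y := f y)) x)"
      by (auto simp: fun_eq_iff)
    with sat have "fo_sat G (\<lambda>x. if x \<in> set xs then f x else (e(y := f y)) x) \<phi>" by (simp only:)
    with f have "fo_sat G (e(y := f y)) (foldr Exists xs \<phi>)" unfolding Cons.IH by auto
    with f show "fo_sat G e (foldr Exists (y # xs) \<phi>)" by auto
  qed
qed simp

lemma free_vars_foldr_Exists: "free_vars (foldr Exists xs \<phi>) = free_vars \<phi> - set xs"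
  by (induction xs) auto

text \<open>Variables below \<open>k\<close> enumerate the clique, and variable \<open>k\<close>
  ranges over possible neighbours outside it. The enumeration is injective without a separate
  clause, because edges join distinct vertices in a loop-free graph.\<close>

definition complete_component_formula :: "nat \<Rightarrow> fo_formula" where
  "complete_component_formula k = foldr Exists [0..<k] (Conj
     (fo_conj (concat (map (\<lambda>i. map (\<lambda>j. Edge i j) (filter (\<lambda>j. j \<noteq> i) [0..<k])) [0..<k])))
     (fo_conj (map (\<lambda>i. Neg (Exists k (Conj (Edge i k) (fo_conj (map (\<lambda>j. Neg (Eq k j)) [0..<k]))))) [0..<k])))"

lemma asserts_complete_component_formula:
  assumes k: "k \<ge> 1"
  shows "asserts_complete_component k (complete_component_formula k)"
  unfolding asserts_complete_component_def
proof (intro conjI allI impI)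
  show "fo_sentence (complete_component_formula k)"
    \<comment> \<open>The variable 0 left free by \<open>fo_conj\<close> is among the bound
      variables since \<open>k \<ge> 1\<close>.\<close>
    using k by (auto simp: fo_sentence_def complete_component_formula_def free_vars_foldr_Exists)
next
  fix G :: "nat pair_pre_digraph" assume "pair_graph G"
  then interpret pair_graph G .
  let ?I = "isolated_cliques k (pverts G) (\<lambda>u v. (u, v) \<in> parcs G)"
  have clique: "fo_sat G g (fo_conj (concat (map (\<lambda>i. map (\<lambda>j. Edge i j) (filter (\<lambda>j. j \<noteq> i) [0..<k])) [0..<k])))
      \<longleftrightarrow> (\<forall>i<k. \<forall>j<k. i \<noteq> j \<longrightarrow> (g i, g j) \<in> parcs G)" for g
    by auto
  have closed: "fo_sat G g (fo_conj (map (\<lambda>i. Neg (Exists k (Conj (Edge i k)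
        (fo_conj (map (\<lambda>j. Neg (Eq k j)) [0..<k]))))) [0..<k]))
      \<longleftrightarrow> (\<forall>i<k. \<forall>v\<in>pverts G. (g i, v) \<in> parcs G \<longrightarrow> (\<exists>j<k. v = g j))" for g
    by (auto simp: Bex_def)
  have sat: "fo_sat G e (complete_component_formula k) \<longleftrightarrow>
      (\<exists>f. (\<forall>i<k. f i \<in> pverts G) \<and> (\<forall>i<k. \<forall>j<k. i \<noteq> j \<longrightarrow> (f i, f j) \<in> parcs G) \<and>
        (\<forall>i<k. \<forall>v\<in>pverts G. (f i, v) \<in> parcs G \<longrightarrow> (\<exists>j<k. v = f j)))" for e
    unfolding complete_component_formula_def fo_sat_foldr_Exists fo_sat.simps clique closed
    by (intro ex_cong1) (simp add: Ball_def cong: conj_cong)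
  have "(\<exists>f. (\<forall>i<k. f i \<in> pverts G) \<and> (\<forall>i<k. \<forall>j<k. i \<noteq> j \<longrightarrow> (f i, f j) \<in> parcs G) \<and>
        (\<forall>i<k. \<forall>v\<in>pverts G. (f i, v) \<in> parcs G \<longrightarrow> (\<exists>j<k. v = f j))) \<longleftrightarrow> ?I \<noteq> {}"
  proof
    assume "\<exists>f. (\<forall>i<k. f i \<in> pverts G) \<and> (\<forall>i<k. \<forall>j<k. i \<noteq> j \<longrightarrow> (f i, f j) \<in> parcs G) \<and>
        (\<forall>i<k. \<forall>v\<in>pverts G. (f i, v) \<in> parcs G \<longrightarrow> (\<exists>j<k. v = f j))"
    then obtain f where f: "\<forall>i<k. f i \<in> pverts G" "\<forall>i<k. \<forall>j<k. i \<noteq> j \<longrightarrow> (f i, f j) \<in> parcs G"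
      "\<forall>i<k. \<forall>v\<in>pverts G. (f i, v) \<in> parcs G \<longrightarrow> (\<exists>j<k. v = f j)" by (elim exE conjE) (rule that)
    have "inj_on f {..<k}"
    proof (rule inj_onI, rule ccontr)
      fix i j assume "i \<in> {..<k}" "j \<in> {..<k}" "f i = f j" "i \<noteq> j"
      with f(2) have "(f i, f i) \<in> parcs G" by (metis lessThan_iff)
      then show False using pair_no_loops[of "(f i, f i)"] by simp
    qed
    then have "card (f ` {..<k}) = k" by (simp add: card_image)
    moreover have "\<forall>u\<in>f ` {..<k}. \<forall>v\<in>pverts G - f ` {..<k}. (u, v) \<notin> parcs G"
    proof (intro ballI notI)
      fix u v assume u: "u \<in> f ` {..<k}" and v: "v \<in> pverts G - f ` {..<k}" and uv: "(u, v) \<in> parcs G"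
      from u obtain i where "i < k" "u = f i" by auto
      with f(3) v uv obtain j where "j < k" "v = f j" by blast
      with v show False by auto
    qed
    moreover have "\<forall>u\<in>f ` {..<k}. \<forall>v\<in>f ` {..<k}. u \<noteq> v \<longrightarrow> (u, v) \<in> parcs G"
      using f(2) by auto
    moreover have "f ` {..<k} \<subseteq> pverts G" using f(1) by auto
    ultimately have "f ` {..<k} \<in> ?I" unfolding isolated_cliques_def by (intro CollectI conjI)
    then show "?I \<noteq> {}" by blast
  next
    assume "?I \<noteq> {}"
    then obtain S where S: "S \<in> ?I" by blast
    then have SV: "S \<subseteq> pverts G" and card: "card S = k"
      and cl: "\<And>u v. u \<in> S \<Longrightarrow> v \<in> S \<Longrightarrow> u \<noteq> v \<Longrightarrow> (u, v) \<in> parcs G"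
      and isol: "\<And>u v. u \<in> S \<Longrightarrow> v \<in> pverts G - S \<Longrightarrow> (u, v) \<notin> parcs G"
      by (auto simp: isolated_cliques_def)
    have "finite S" using k card by (intro card_ge_0_finite) simp
    then obtain f where f: "bij_betw f {..<k} S"
      using card by (metis bij_betw_iff_card card_lessThan finite_lessThan)
    then have fS: "f ` {..<k} = S" and inj: "inj_on f {..<k}" by (auto simp: bij_betw_def)
    have fi: "f i \<in> S" if "i < k" for i using fS that by blast
    then have V: "\<forall>i<k. f i \<in> pverts G" using SV by blast
    have "\<forall>i<k. \<forall>j<k. i \<noteq> j \<longrightarrow> (f i, f j) \<in> parcs G"
    proof (intro allI impI)
      fix i j assume ij: "i < k" "j < k" "i \<noteq> j"
      then have "f i \<noteq> f j" using inj by (auto dest: inj_onD)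
      then show "(f i, f j) \<in> parcs G" using ij by (intro cl fi)
    qed
    moreover have "\<exists>j<k. v = f j" if iv: "i < k" "v \<in> pverts G" "(f i, v) \<in> parcs G" for i v
    proof -
      have "v \<in> S" using isol[OF fi[OF iv(1)], of v] iv by blast
      then show ?thesis unfolding fS[symmetric] by auto
    qed
    ultimately show "\<exists>f. (\<forall>i<k. f i \<in> pverts G) \<and> (\<forall>i<k. \<forall>j<k. i \<noteq> j \<longrightarrow> (f i, f j) \<in> parcs G) \<and>
        (\<forall>i<k. \<forall>v\<in>pverts G. (f i, v) \<in> parcs G \<longrightarrow> (\<exists>j<k. v = f j))"
      using V by (intro exI[of _ f]) simp
  qed
  moreover have "?I \<noteq> {} \<longleftrightarrow> complete_components k G \<noteq> {}"
    using bij_betw_imp_surj_on[OF bij_betw_complete_components[OF k]] by (metis image_is_empty)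
  ultimately show "fo_models G (complete_component_formula k) \<longleftrightarrow> complete_components k G \<noteq> {}"
    unfolding fo_models_def sat by simp
qed

section \<open>The Poisson limit\<close>

lemma pair_graph_geometric_graph: "pair_graph (geometric_graph D n r x)"
proof
  have sym: "torus_dist D (x i) (x j) = torus_dist D (x j) (x i)" for i j
    by (simp add: torus_dist_def dist_commute)
  show "fst e \<in> pverts (geometric_graph D n r x)" "snd e \<in> pverts (geometric_graph D n r x)" "fst e \<noteq> snd e"
    if "e \<in> parcs (geometric_graph D n r x)" for e
    using that by (auto simp: geometric_graph_def)
  show "finite (pverts (geometric_graph D n r x))" by (simp add: geometric_graph_def)
  show "finite (parcs (geometric_graph D n r x))"
    by (rule finite_subset[of _ "{1..n} \<times> {1..n}"]) (auto simp: geometric_graph_def)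
  show "symmetric (with_proj (geometric_graph D n r x))"
    unfolding symmetric_def with_proj_simps by (rule symI) (auto simp: geometric_graph_def sym)
qed

lemma complete_components_geometric_graph:
  fixes x :: "nat \<Rightarrow> nat \<Rightarrow> circle" and D n :: nat and r :: real
  assumes k: "k \<ge> 1"
  defines "S \<equiv> isolated_cliques k {1..n} (\<lambda>u v. torus_dist D (x u) (x v) \<le> r)"
  shows "card (complete_components k (geometric_graph D n r x)) = card S"
    and "complete_components k (geometric_graph D n r x) \<noteq> {} \<longleftrightarrow> card S \<noteq> 0"
proof -
  let ?G = "geometric_graph D n r x"
  have "isolated_cliques k (pverts ?G) (\<lambda>u v. (u, v) \<in> parcs ?G) = S"
    unfolding isolated_cliques_def S_def geometric_graph_def pair_pre_digraph.simps
    by (intro Collect_cong conj_cong refl ball_cong imp_cong) auto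
  then have bij: "bij_betw verts (complete_components k ?G) S"
    using pair_graph.bij_betw_complete_components[OF pair_graph_geometric_graph k] by metis
  then show "card (complete_components k ?G) = card S" by (rule bij_betw_same_card)
  have "finite S"
    unfolding S_def isolated_cliques_def by (rule finite_subset[of _ "Pow {1..n}"]) auto
  then have "S \<noteq> {} \<longleftrightarrow> card S \<noteq> 0" by simp
  then show "complete_components k ?G \<noteq> {} \<longleftrightarrow> card S \<noteq> 0"
    using bij_betw_imp_surj_on[OF bij] by (metis image_is_empty)
qed

text \<open>Dividing the convergent sequence by \<open>n\<close> leaves
  \<open>(n r^D)^(k - 1)\<close>, which therefore tends to 0. The exponent is positive because
  \<open>k \<ge> 2\<close>.\<close>

lemma edge_scale_tendsto_0:
  fixes r :: "nat \<Rightarrow> real"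
  assumes D: "D \<ge> 1" and k: "k \<ge> 2" and r: "\<And>n. 0 \<le> r n"
    and lim: "(\<lambda>n. real n ^ k * r n ^ (D * (k - 1))) \<longlonglongrightarrow> a"
  shows "(\<lambda>n. real n * r n ^ D) \<longlonglongrightarrow> 0" and "r \<longlonglongrightarrow> 0"
proof -
  have "(\<lambda>n. real n ^ k * r n ^ (D * (k - 1)) * inverse (real n)) \<longlonglongrightarrow> a * 0"
    by (intro tendsto_mult lim lim_inverse_n)
  moreover have "eventually (\<lambda>n. real n ^ k * r n ^ (D * (k - 1)) * inverse (real n) =
      (real n * r n ^ D) ^ (k - 1)) sequentially"
    using eventually_gt_at_top[of 0]
  proof eventually_elim
    case (elim n)
    have "real n ^ k = real n * real n ^ (k - 1)" using k by (cases k) auto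
    then show ?case using elim by (simp add: power_mult_distrib power_mult)
  qed
  ultimately have "(\<lambda>n. (real n * r n ^ D) ^ (k - 1)) \<longlonglongrightarrow> 0" by (simp add: tendsto_cong)
  then show nr: "(\<lambda>n. real n * r n ^ D) \<longlonglongrightarrow> 0"
    using k by (subst (asm) power_tendsto_0_iff) auto
  have "(\<lambda>n. r n ^ D) \<longlonglongrightarrow> 0"
  proof (rule tendsto_sandwich[OF _ _ tendsto_const nr])
    show "\<forall>\<^sub>F n in sequentially. 0 \<le> r n ^ D" using r by simp
    show "\<forall>\<^sub>F n in sequentially. r n ^ D \<le> real n * r n ^ D"
      using eventually_ge_at_top[of 1]
    proof eventually_elim
      case (elim n)
      then have "1 * r n ^ D \<le> real n * r n ^ D" using r by (intro mult_right_mono) auto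
      then show ?case by simp
    qed
  qed
  then show "r \<longlonglongrightarrow> 0" using D by (subst (asm) power_tendsto_0_iff) auto
qed

text \<open>Squeezing: with \<open>x\<close> and \<open>y\<close> as in the proof, both bounds,
  summed over all packings, are the normalised packing count times expressions in \<open>x\<close>
  and \<open>y\<close>. The error carries the factor \<open>y\<close>, which tends to 0, and so
  vanishes beside the main term.\<close>

lemma packing_sum_tendsto:
  fixes r :: "nat \<Rightarrow> real" and p :: "nat \<Rightarrow> nat set set \<Rightarrow> real"
  assumes D: "D \<ge> 1" and k: "k \<ge> 2" and r: "\<And>n. 0 \<le> r n"
    and lim: "(\<lambda>n. real n ^ k * r n ^ (D * (k - 1))) \<longlonglongrightarrow> a"
    and bounds: "\<And>n F. r n < 1/3 \<Longrightarrow> F \<in> packings k m {1..n} \<Longrightarrow>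
      (real k * r n ^ (k - 1)) ^ (m * D) - real (m * k * n) * (4 * r n) ^ ((m * (k - 1) + 1) * D) \<le> p n F \<and>
      p n F \<le> (real k * r n ^ (k - 1)) ^ (m * D)"
  shows "(\<lambda>n. \<Sum>F\<in>packings k m {1..n}. p n F) \<longlonglongrightarrow> (real k ^ D / fact k * a) ^ m / fact m"
proof -
  note scale = edge_scale_tendsto_0[OF D k r lim]
  define N where "N n = real (card (packings k m {1..n}))" for n :: nat
  define x where "x n = real n ^ k * r n ^ (D * (k - 1))" for n
  define y where "y n = real n * r n ^ D" for n
  \<comment> \<open>The \<open>m * k\<close> vertices that an outgoing edge can start from, together
    with the powers of 4; the \<open>n\<close> endpoints of the edge go into
    \<open>y\<close>.\<close>
  define c where "c = real (m * k) * 4 ^ ((m * (k - 1) + 1) * D)"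
  have N: "(\<lambda>n. N n / real n ^ (k * m)) \<longlonglongrightarrow> 1 / (fact k ^ m * fact m)"
    unfolding N_def using k by (intro card_packings_asymp) simp
  have x: "x \<longlonglongrightarrow> a" and y: "y \<longlonglongrightarrow> 0" using lim scale(1) by (simp_all add: x_def[abs_def] y_def[abs_def])
  have upper: "N n * (real k * r n ^ (k - 1)) ^ (m * D) = N n / real n ^ (k * m) * (real k ^ D * x n) ^ m"
    if "n > 0" for n
  proof -
    have "(real k * r n ^ (k - 1)) ^ (m * D) = (real k ^ D * r n ^ (D * (k - 1))) ^ m"
      by (simp add: power_mult_distrib power_mult[symmetric] mult_ac)
    moreover have "(real k ^ D * x n) ^ m = real n ^ (k * m) * (real k ^ D * r n ^ (D * (k - 1))) ^ m"
      by (simp add: x_def power_mult_distrib power_mult)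
    ultimately show ?thesis using that by simp
  qed
  have error: "N n * (real (m * k * n) * (4 * r n) ^ ((m * (k - 1) + 1) * D)) =
      N n / real n ^ (k * m) * (c * x n ^ m * y n)" if "n > 0" for n
  proof -
    have "(4 * r n) ^ ((m * (k - 1) + 1) * D) = 4 ^ ((m * (k - 1) + 1) * D) * ((r n ^ (D * (k - 1))) ^ m * r n ^ D)"
      by (simp add: power_mult_distrib power_mult[symmetric] power_add[symmetric] algebra_simps)
    moreover have "x n ^ m = real n ^ (k * m) * (r n ^ (D * (k - 1))) ^ m"
      by (simp add: x_def power_mult_distrib power_mult)
    ultimately show ?thesis using that by (simp add: c_def y_def)
  qed
  have U: "(\<lambda>n. N n / real n ^ (k * m) * (real k ^ D * x n) ^ m) \<longlonglongrightarrow> (real k ^ D / fact k * a) ^ m / fact m"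
  proof -
    have "(\<lambda>n. N n / real n ^ (k * m) * (real k ^ D * x n) ^ m) \<longlonglongrightarrow>
        1 / (fact k ^ m * fact m) * (real k ^ D * a) ^ m"
      by (intro tendsto_intros N x)
    then show ?thesis by (simp add: power_mult_distrib power_divide)
  qed
  have "(\<lambda>n. N n / real n ^ (k * m) * (c * x n ^ m * y n)) \<longlonglongrightarrow> 1 / (fact k ^ m * fact m) * (c * a ^ m * 0)"
    by (intro tendsto_intros N x y)
  then have L: "(\<lambda>n. N n / real n ^ (k * m) * (real k ^ D * x n) ^ m - N n / real n ^ (k * m) * (c * x n ^ m * y n))
      \<longlonglongrightarrow> (real k ^ D / fact k * a) ^ m / fact m"
    using tendsto_diff[OF U] by fastforce
  have small: "eventually (\<lambda>n. n > 0 \<and> r n < 1/3) sequentially"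
    using eventually_gt_at_top[of 0] order_tendstoD(2)[OF scale(2), of "1/3"] by (simp add: eventually_conj)
  show ?thesis
  proof (rule tendsto_sandwich[OF _ _ L U])
    show "eventually (\<lambda>n. N n / real n ^ (k * m) * (real k ^ D * x n) ^ m - N n / real n ^ (k * m) * (c * x n ^ m * y n)
        \<le> (\<Sum>F\<in>packings k m {1..n}. p n F)) sequentially"
      using small
    proof eventually_elim
      case (elim n)
      then have "(\<Sum>F\<in>packings k m {1..n}. (real k * r n ^ (k - 1)) ^ (m * D) -
            real (m * k * n) * (4 * r n) ^ ((m * (k - 1) + 1) * D)) \<le> (\<Sum>F\<in>packings k m {1..n}. p n F)"
        using bounds by (intro sum_mono) blast
      with elim show ?case
        by (simp only: sum_constant N_def[symmetric] right_diff_distrib upper error)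
    qed
    show "eventually (\<lambda>n. (\<Sum>F\<in>packings k m {1..n}. p n F) \<le> N n / real n ^ (k * m) * (real k ^ D * x n) ^ m) sequentially"
      using small
    proof eventually_elim
      case (elim n)
      then have "(\<Sum>F\<in>packings k m {1..n}. p n F) \<le> (\<Sum>F\<in>packings k m {1..n}. (real k * r n ^ (k - 1)) ^ (m * D))"
        using bounds by (intro sum_mono) blast
      with elim show ?case by (simp only: sum_constant N_def[symmetric] upper)
    qed
  qed
qed

theorem corollary1p5:
  fixes D k :: nat
    and r :: "nat \<Rightarrow> real"
    and a :: real
    and M :: "nat \<Rightarrow> 'w measure"
    and X :: "nat \<Rightarrow> nat \<Rightarrow> 'w \<Rightarrow> nat \<Rightarrow> circle"
    and G :: "nat \<Rightarrow> 'w \<Rightarrow> nat pair_pre_digraph"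
    and C :: "nat \<Rightarrow> 'w \<Rightarrow> nat"
  assumes "D \<ge> 1" and "k \<ge> 2"
    and "\<And>n. r n \<in> {0..1/2}"
    and "\<And>n. prob_space (M n)"
    and "\<And>n. prob_space.indep_vars (M n) (\<lambda>_. torus_uniform D) (X n) {1..n}"
    and "\<And>n i. i \<in> {1..n} \<Longrightarrow> distr (M n) (torus_uniform D) (X n i) = torus_uniform D"
    and G_def: "\<And>n \<omega>. G n \<omega> = geometric_graph D n (r n) (\<lambda>i. X n i \<omega>)"
    and C_def: "\<And>n \<omega>. C n \<omega> = card (complete_components k (G n \<omega>))"
    and "a \<ge> 0"
    and "(\<lambda>n. real n ^ k * r n ^ (D * (k - 1))) \<longlonglongrightarrow> a"
  shows "weak_conv_m
           (\<lambda>n. distr (M n) borel (\<lambda>\<omega>. real (C n \<omega>)))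
           (distr (measure_pmf (poisson_dist (real k ^ D / fact k * a))) borel real)
       \<and> (a > 0 \<longrightarrow>
           (\<exists>\<phi>. asserts_complete_component k \<phi>)
         \<and> (\<forall>\<phi>. asserts_complete_component k \<phi> \<longrightarrow>
             (\<lambda>n. measure (M n) {\<omega> \<in> space (M n). fo_models (G n \<omega>) \<phi>})
               \<longlonglongrightarrow> 1 - exp (- (real k ^ D / fact k * a)))
         \<and> 0 < 1 - exp (- (real k ^ D / fact k * a))
         \<and> 1 - exp (- (real k ^ D / fact k * a)) < 1)"
proof -
  define \<mu> where "\<mu> = real k ^ D / fact k * a"
  have k1: "k \<ge> 1" and r0: "\<And>n. 0 \<le> r n" and \<mu>0: "\<mu> \<ge> 0"
    using assms(2,3,9) by (auto simp: \<mu>_def)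
  have samp: "torus_sample (M n) D {1..n} (X n)" for n
    unfolding torus_sample_def torus_sample_axioms_def
    using assms(1,4,5,6) by auto
  define S where "S n \<omega> = isolated_cliques k {1..n} (\<lambda>u v. torus_dist D (X n u \<omega>) (X n v \<omega>) \<le> r n)" for n \<omega>
  have CS: "C n \<omega> = card (S n \<omega>)" for n \<omega>
    unfolding C_def G_def S_def by (rule complete_components_geometric_graph(1)[OF k1])
  have meas: "C n \<in> measurable (M n) (count_space UNIV)" for n
    using torus_sample.measurable_card_isolated_cliques[OF samp] unfolding CS[abs_def] S_def .
  have finP: "finite (packings k m {1..n})" for m n :: nat by (rule finite_packings) simp
  have ev: "{\<omega> \<in> space (M n). F \<subseteq> S n \<omega>} \<in> sets (M n)" if "F \<in> packings k m {1..n}" for n m F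
    unfolding S_def using that by (intro torus_sample.isolated_packing_event[OF samp]) (simp add: packings_def)
  have choose: "C n \<omega> choose m = card {F \<in> packings k m {1..n}. F \<subseteq> S n \<omega>}" for n m \<omega>
    unfolding CS S_def by (rule card_isolated_cliques_choose) simp
  define p where "p n F = measure (M n) {\<omega> \<in> space (M n). F \<subseteq> S n \<omega>}" for n F
  define b where "b n m = integral\<^sup>L (M n) (\<lambda>\<omega>. real (C n \<omega> choose m))" for n m
  have b_eq: "b n m = (\<Sum>F\<in>packings k m {1..n}. p n F)" for n m
    unfolding b_def p_def
    by (rule prob_space.expectation_choose(2)[OF assms(4) finP]) (rule ev choose; assumption)+
  have int: "integrable (M n) (\<lambda>\<omega>. real (C n \<omega> choose m))" for n m
    by (rule prob_space.expectation_choose(1)[OF assms(4) finP]) (rule ev choose; assumption)+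
  have b_lim: "(\<lambda>n. b n m) \<longlonglongrightarrow> \<mu> ^ m / fact m" for m
    unfolding b_eq \<mu>_def
  proof (rule packing_sum_tendsto[OF assms(1,2) r0 assms(10)])
    fix n F assume r: "r n < 1/3" and F: "F \<in> packings k m {1..n}"
    show "(real k * r n ^ (k - 1)) ^ (m * D) - real (m * k * n) * (4 * r n) ^ ((m * (k - 1) + 1) * D) \<le> p n F \<and>
      p n F \<le> (real k * r n ^ (k - 1)) ^ (m * D)"
      using torus_sample.prob_isolated_packing[OF samp F k1 r0 r] unfolding p_def S_def by simp
  qed
  have lim: "(\<lambda>n. measure (M n) {\<omega> \<in> space (M n). C n \<omega> = j}) \<longlonglongrightarrow> \<mu> ^ j / fact j * exp (- \<mu>)" for j
  proof (rule factorial_moments_poisson[OF _ b_lim])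
    show "\<bar>measure (M n) {\<omega> \<in> space (M n). C n \<omega> = j} - (\<Sum>i\<le>N. (-1) ^ i * real (j + i choose j) * b n (j + i))\<bar>
      \<le> real (j + Suc N choose j) * b n (j + Suc N)" for n N
      unfolding b_def by (rule prob_space.bonferroni_expectation[OF assms(4) meas int])
  qed
  have conv: "weak_conv_m (\<lambda>n. distr (M n) borel (\<lambda>\<omega>. real (C n \<omega>)))
      (distr (measure_pmf (poisson_dist \<mu>)) borel real)"
    by (rule weak_conv_m_nat[OF assms(4) meas]) (simp only: pmf_poisson_dist[OF \<mu>0] lim)
  \<comment> \<open>On simple graphs the truth of any such sentence is equivalent to
    \<open>C n \<omega> \<noteq> 0\<close>, so only the point probability at 0 is involved.\<close>
  have models: "(\<lambda>n. measure (M n) {\<omega> \<in> space (M n). fo_models (G n \<omega>) \<phi>}) \<longlonglongrightarrow> 1 - exp (- \<mu>)"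
    if \<phi>: "asserts_complete_component k \<phi>" for \<phi>
  proof -
    have "fo_models (G n \<omega>) \<phi> \<longleftrightarrow> C n \<omega> \<noteq> 0" for n \<omega>
      using \<phi> pair_graph_geometric_graph complete_components_geometric_graph(2)[OF k1]
      unfolding asserts_complete_component_def CS S_def G_def by metis
    moreover have "measure (M n) {\<omega> \<in> space (M n). C n \<omega> \<noteq> 0} =
        1 - measure (M n) {\<omega> \<in> space (M n). C n \<omega> = 0}" for n
    proof -
      have "{\<omega> \<in> space (M n). C n \<omega> = 0} \<in> sets (M n)"
        using measurable_sets[OF meas, of "{0}" n] by (simp add: vimage_def Int_def conj_commute)
      moreover have "{\<omega> \<in> space (M n). C n \<omega> \<noteq> 0} = space (M n) - {\<omega> \<in> space (M n). C n \<omega> = 0}" by auto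
      ultimately show ?thesis using prob_space.prob_compl[OF assms(4)] by simp
    qed
    ultimately show ?thesis
      using tendsto_diff[OF tendsto_const lim[of 0], of 1] by simp
  qed
  have "0 < 1 - exp (- \<mu>) \<and> 1 - exp (- \<mu>) < 1" if "a > 0"
    using that k1 by (simp add: \<mu>_def)
  then show ?thesis
    using conv models asserts_complete_component_formula[OF k1] unfolding \<mu>_def by blast
qed

end
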